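(* Let $\beta_2>\beta_1>0$ and let $\gamma:\mathbb{R}\to\mathbb{R}^2$, $\gamma(t)=(|t|^{\beta_1}\operatorname{sign} t,\ |t|^{\beta_2}\operatorname{sign} t)$. Let $H_\gamma f(x)=\int_{\mathbb{R}} f(x-\gamma(t))\,\frac{dt}{t}$ be the Hilbert transform along $\gamma$. Let $b\in L^1_{\mathrm{loc}}(\mathbb{R}^2;\mathbb{C})$ and $1<p<\infty$, and suppose that the commutator $[b,H_\gamma]$ is a bounded operator on $L^p=L^p(\mathbb{R}^2)$. Then $b\in \mathrm{BMO}_\gamma(\mathbb{R}^2)$, and in fact $$\|b\|_{\mathrm{BMO}_\gamma(\mathbb{R}^2)}\le C\,\|[b,H_\gamma]\|_{L^p\to L^p},$$ where the constant $C$ depends only on $\beta_1,\beta_2,p$ (in particular not on $b$).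
   Context: The commutator is $[b,H_\gamma]f:=bH_\gamma f-H_\gamma(bf)$. The integral defining $H_\gamma$ is understood in the principal value sense. Boundedness of $[b,H_\gamma]$ on $L^p$ means that there is $N<\infty$ such that for all bounded compactly supported $f$ the function $[b,H_\gamma]f$ is defined a.e. and $\|[b,H_\gamma]f\|_{L^p}\le N\|f\|_{L^p}$; $\|[b,H_\gamma]\|_{L^p\to L^p}$ is the least such $N$. For a set $Q$ of finite positive measure, $\langle b\rangle_Q:=\frac1{|Q|}\int_Q b$. The space $\mathrm{BMO}_\gamma(\mathbb{R}^2)$ consists of those locally integrable $b$ with $$\|b\|_{\mathrm{BMO}_\gamma(\mathbb{R}^2)}:=\sup_{Q}\frac1{|Q|}\int_Q|b-\langle b\rangle_Q|<\infty,$$ where the supremum is over all axis-parallel rectangles $Q=I\times J$ ($I,J\subset\mathbb{R}$ intervals of lengths $\ell(I),\ell(J)$) with $\ell(I)^{1/\beta_1}=\ell(J)^{1/\beta_2}$. *)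

theory Defs
  imports "HOL-Analysis.Analysis"
begin

definition curve :: "real \<Rightarrow> real \<Rightarrow> real \<Rightarrow> real \<times> real" where
  "curve \<beta>1 \<beta>2 t = (\<bar>t\<bar> powr \<beta>1 * sgn t, \<bar>t\<bar> powr \<beta>2 * sgn t)"

definition hilbert_integrand ::
  "real \<Rightarrow> real \<Rightarrow> (real \<times> real \<Rightarrow> complex) \<Rightarrow> real \<times> real \<Rightarrow> real \<Rightarrow> complex" where
  "hilbert_integrand \<beta>1 \<beta>2 f x t = f (x - curve \<beta>1 \<beta>2 t) / complex_of_real t"

definition trunc_hilbert ::
  "real \<Rightarrow> real \<Rightarrow> real \<Rightarrow> (real \<times> real \<Rightarrow> complex) \<Rightarrow> real \<times> real \<Rightarrow> complex" where
  "trunc_hilbert \<beta>1 \<beta>2 \<epsilon> f x =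
     (LINT t:{t. \<epsilon> < \<bar>t\<bar>}|lebesgue. hilbert_integrand \<beta>1 \<beta>2 f x t)"

text \<open>
  The principal value is taken at \<open>t = 0\<close> only: the operator is applied to compactly supported
  functions, for which the integrand vanishes for large \<open>\<bar>t\<bar>\<close>.
\<close>

definition hilbert_defined_at ::
  "real \<Rightarrow> real \<Rightarrow> (real \<times> real \<Rightarrow> complex) \<Rightarrow> real \<times> real \<Rightarrow> bool" where
  "hilbert_defined_at \<beta>1 \<beta>2 f x \<longleftrightarrow>
     (\<forall>\<epsilon>>0. set_integrable lebesgue {t. \<epsilon> < \<bar>t\<bar>} (hilbert_integrand \<beta>1 \<beta>2 f x)) \<and>
     (\<exists>l. ((\<lambda>\<epsilon>. trunc_hilbert \<beta>1 \<beta>2 \<epsilon> f x) \<longlongrightarrow> l) (at_right 0))"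

text \<open>Meaningful only at points satisfying \<open>hilbert_defined_at\<close>.\<close>

definition hilbert ::
  "real \<Rightarrow> real \<Rightarrow> (real \<times> real \<Rightarrow> complex) \<Rightarrow> real \<times> real \<Rightarrow> complex" where
  "hilbert \<beta>1 \<beta>2 f x = Lim (at_right 0) (\<lambda>\<epsilon>. trunc_hilbert \<beta>1 \<beta>2 \<epsilon> f x)"

definition commutator ::
  "real \<Rightarrow> real \<Rightarrow> (real \<times> real \<Rightarrow> complex) \<Rightarrow> (real \<times> real \<Rightarrow> complex) \<Rightarrow> real \<times> real \<Rightarrow> complex" where
  "commutator \<beta>1 \<beta>2 b f x = b x * hilbert \<beta>1 \<beta>2 f x - hilbert \<beta>1 \<beta>2 (\<lambda>y. b y * f y) x"

definition commutator_defined_at ::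
  "real \<Rightarrow> real \<Rightarrow> (real \<times> real \<Rightarrow> complex) \<Rightarrow> (real \<times> real \<Rightarrow> complex) \<Rightarrow> real \<times> real \<Rightarrow> bool" where
  "commutator_defined_at \<beta>1 \<beta>2 b f x \<longleftrightarrow>
     hilbert_defined_at \<beta>1 \<beta>2 f x \<and> hilbert_defined_at \<beta>1 \<beta>2 (\<lambda>y. b y * f y) x"

definition Lp_norm :: "real \<Rightarrow> (real \<times> real \<Rightarrow> complex) \<Rightarrow> ennreal" where
  "Lp_norm p f =
     (let I = (\<integral>\<^sup>+ x. ennreal (norm (f x) powr p) \<partial>lebesgue)
      in if I = \<infinity> then \<infinity> else ennreal (enn2real I powr (1 / p)))"

definition bdd_compact_supp :: "(real \<times> real \<Rightarrow> complex) set" where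
  "bdd_compact_supp =
     {f \<in> borel_measurable lebesgue. bounded (range f) \<and> compact (closure {x. f x \<noteq> 0})}"

definition commutator_bound ::
  "real \<Rightarrow> real \<Rightarrow> real \<Rightarrow> (real \<times> real \<Rightarrow> complex) \<Rightarrow> ennreal \<Rightarrow> bool" where
  "commutator_bound \<beta>1 \<beta>2 p b N \<longleftrightarrow>
     N < \<infinity> \<and>
     (\<forall>f \<in> bdd_compact_supp.
        (AE x in lebesgue. commutator_defined_at \<beta>1 \<beta>2 b f x) \<and>
        Lp_norm p (commutator \<beta>1 \<beta>2 b f) \<le> N * Lp_norm p f)"

definition commutator_bounded ::
  "real \<Rightarrow> real \<Rightarrow> real \<Rightarrow> (real \<times> real \<Rightarrow> complex) \<Rightarrow> bool" where
  "commutator_bounded \<beta>1 \<beta>2 p b \<longleftrightarrow> (\<exists>N. commutator_bound \<beta>1 \<beta>2 p b N)"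

definition commutator_norm ::
  "real \<Rightarrow> real \<Rightarrow> real \<Rightarrow> (real \<times> real \<Rightarrow> complex) \<Rightarrow> ennreal" where
  "commutator_norm \<beta>1 \<beta>2 p b = Inf {N. commutator_bound \<beta>1 \<beta>2 p b N}"

definition locally_integrable :: "(real \<times> real \<Rightarrow> complex) \<Rightarrow> bool" where
  "locally_integrable b \<longleftrightarrow> (\<forall>K. compact K \<longrightarrow> set_integrable lebesgue K b)"

definition average :: "(real \<times> real) set \<Rightarrow> (real \<times> real \<Rightarrow> complex) \<Rightarrow> complex" where
  "average Q b = (LINT x:Q|lebesgue. b x) / complex_of_real (measure lebesgue Q)"

definition mean_oscillation :: "(real \<times> real) set \<Rightarrow> (real \<times> real \<Rightarrow> complex) \<Rightarrow> real" where
  "mean_oscillation Q b =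
     (LINT x:Q|lebesgue. norm (b x - average Q b)) / measure lebesgue Q"

text \<open>Intervals are taken closed; endpoints do not affect averages or oscillations.\<close>

definition curve_rectangles :: "real \<Rightarrow> real \<Rightarrow> (real \<times> real) set set" where
  "curve_rectangles \<beta>1 \<beta>2 =
     {{a..b} \<times> {c..d} | a b c d.
        a < b \<and> c < d \<and> (b - a) powr (1 / \<beta>1) = (d - c) powr (1 / \<beta>2)}"

definition BMO_norm :: "real \<Rightarrow> real \<Rightarrow> (real \<times> real \<Rightarrow> complex) \<Rightarrow> ennreal" where
  "BMO_norm \<beta>1 \<beta>2 b = (SUP Q \<in> curve_rectangles \<beta>1 \<beta>2. ennreal (mean_oscillation Q b))"

definition BMO :: "real \<Rightarrow> real \<Rightarrow> (real \<times> real \<Rightarrow> complex) set" where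
  "BMO \<beta>1 \<beta>2 = {b. locally_integrable b \<and> BMO_norm \<beta>1 \<beta>2 b < \<infinity>}"

end

theory Submission
  imports Defs
begin

text \<open>
  Write \<open>\<alpha> = \<beta>2 / \<beta>1 > 1\<close> and \<open>\<gamma>\<close> for the curve; with \<open>u = t powr \<beta>1\<close> its part over \<open>t > 0\<close> is
  the graph \<open>(u, u powr \<alpha>)\<close>, and \<open>dt / t\<close> is a multiple of \<open>du / u\<close>. The measure defining the
  Hilbert transform lives on a curve, so a single application of it cannot compare the values of
  \<open>b\<close> on two rectangles. Two successive steps can: since \<open>\<alpha> > 1\<close>, the tangents of the curve at
  two different positive parameters are independent, so the points \<open>x - \<gamma> t - \<gamma> s\<close> with \<open>t\<close>, \<open>s\<close>
  near two different values fill out an open set, with a density bounded below.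

  Concretely, let \<open>near\<close> be a rectangle of the required shape, put \<open>S\<close> equal to a large multiple
  of its width, and let \<open>far\<close> be its translate by \<open>\<gamma> t0 + \<gamma> s0\<close>, where \<open>t0\<close>, \<open>s0\<close> are the
  parameters with \<open>u = 2 * S\<close> and \<open>u = S\<close>. A rectangle \<open>mid\<close> catches the intermediate points
  \<open>w = x - \<gamma> t\<close>. Because the three rectangles are separated along the curve, only parameters \<open>t\<close>
  of size comparable to \<open>S powr (1 / \<beta>1)\<close> enter, there is no principal value, and the operator
  "step from far to mid, then from mid to near" has a positive kernel. Lemma
  \<open>two_step_kernel_lower_bound\<close> says that this kernel is at least a constant over the area of
  \<open>near\<close>; the exponents are such that the constant is the same at every scale.

  The commutator of \<open>b\<close> with a composition obeys the product rule, that is,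
  \<open>b x - b z = (b x - b w) + (b w - b z)\<close>. So the two-step commutator tested on the indicator of a
  set \<open>E \<subseteq> near\<close> is controlled by two applications of the hypothesis: one to the indicator of
  \<open>E\<close>, observed on \<open>mid\<close>, and one to the (bounded) transform of this indicator restricted to
  \<open>mid\<close>, observed on \<open>far\<close>. This is \<open>far_to_near_estimate\<close>.

  To turn this into a bound for the oscillation, let \<open>m\<close> be a median of \<open>Re b\<close> on \<open>far\<close>, take
  \<open>E = {z \<in> near. m \<le> Re (b z)}\<close>, and observe the result on a set \<open>F \<subseteq> far\<close> of at least half
  measure on which \<open>Re b \<le> m\<close>. There \<open>Re (b z) - Re (b x)\<close> is nonnegative for all pairs, no
  cancellation is possible, and the kernel bound yields control of the integral of the positive
  part of \<open>Re b - m\<close> over \<open>near\<close> (\<open>one_sided_oscillation\<close>). Applied to \<open>b\<close>, \<open>- b\<close>,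
  \<open>- \<i> * b\<close> and \<open>\<i> * b\<close>, this bounds the mean oscillation of \<open>b\<close>.
\<close>

section \<open>Measure-theoretic preliminaries\<close>

text \<open>
  The infimum of the levels below which at least half of the measure lies is a median: continuity
  of the measure from above gives the first inequality at this level, continuity from below
  applied to the levels just under it gives the second one.
\<close>

lemma (in finite_measure) ex_median:
  fixes f :: "'a \<Rightarrow> real"
  assumes [measurable]: "f \<in> borel_measurable M"
  obtains m where "measure M (space M) \<le> 2 * measure M {x \<in> space M. f x \<le> m}"
    and "measure M (space M) \<le> 2 * measure M {x \<in> space M. m \<le> f x}"
proof (cases "measure M (space M) = 0")
  case True
  then show thesis
    using that[of 0] by simp
next
  case False
  define T where "T = measure M (space M)"
  define F where "F r = measure M {x \<in> space M. f x \<le> r}" for r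
  have T: "0 < T"
    using False by (simp add: T_def zero_less_measure_iff)
  have mono: "F r \<le> F s" if "r \<le> s" for r s
    unfolding F_def using that by (intro finite_measure_mono) auto
  have "(\<lambda>n. F (real n)) \<longlonglongrightarrow> measure M (\<Union>n. {x \<in> space M. f x \<le> real n})"
    unfolding F_def by (intro finite_Lim_measure_incseq) (auto simp: incseq_def)
  also have "(\<Union>n. {x \<in> space M. f x \<le> real n}) = space M"
    using real_arch_simple by auto
  finally have "(\<lambda>n. F (real n)) \<longlonglongrightarrow> T"
    by (simp add: T_def)
  then have "eventually (\<lambda>n. T / 2 < F (real n)) sequentially"
    using T by (intro order_tendstoD) auto
  then obtain n1 where n1: "T / 2 < F (real n1)"
    by (auto simp: eventually_sequentially)
  have "(\<lambda>n. F (- real n)) \<longlonglongrightarrow> measure M (\<Inter>n. {x \<in> space M. f x \<le> - real n})"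
    unfolding F_def by (intro finite_Lim_measure_decseq) (auto simp: decseq_def)
  also have "(\<Inter>n. {x \<in> space M. f x \<le> - real n}) = {}"
  proof -
    have "\<exists>n. \<not> f x \<le> - real n" for x
      using reals_Archimedean2[of "- f x"] by (metis minus_less_iff not_le)
    then show ?thesis
      by blast
  qed
  finally have "(\<lambda>n. F (- real n)) \<longlonglongrightarrow> 0"
    by simp
  then have "eventually (\<lambda>n. F (- real n) < T / 2) sequentially"
    using T by (intro order_tendstoD) auto
  then obtain n2 where n2: "F (- real n2) < T / 2"
    by (auto simp: eventually_sequentially)
  define A where "A = {r. T / 2 \<le> F r}"
  define m where "m = Inf A"
  have "real n1 \<in> A"
    using n1 by (simp add: A_def)
  have lb: "- real n2 \<le> r" if "r \<in> A" for r
    using that n2 mono[of r "- real n2"] by (force simp: A_def)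
  have "bdd_below A"
    using lb by (rule bdd_belowI)
  have ge: "T / 2 \<le> F (m + 1 / Suc n)" for n
  proof -
    have "Inf A < m + 1 / Suc n"
      by (simp add: m_def)
    then obtain r where "r \<in> A" "r < m + 1 / Suc n"
      using cInf_lessD \<open>real n1 \<in> A\<close> by blast
    then show ?thesis
      using mono[of r "m + 1 / Suc n"] by (simp add: A_def)
  qed
  have lt: "F (m - 1 / Suc n) \<le> T / 2" for n
  proof (rule ccontr)
    assume "\<not> F (m - 1 / Suc n) \<le> T / 2"
    then have "m - 1 / Suc n \<in> A"
      by (simp add: A_def)
    then have "m \<le> m - 1 / Suc n"
      unfolding m_def using \<open>bdd_below A\<close> by (rule cInf_lower)
    then show False
      by simp
  qed
  have inv: "1 / real (Suc n) \<le> 1 / real (Suc k)" if "k \<le> n" for k n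
    using that by (simp add: frac_le)
  have "(\<lambda>n. F (m + 1 / Suc n)) \<longlonglongrightarrow> measure M (\<Inter>n. {x \<in> space M. f x \<le> m + 1 / Suc n})"
    unfolding F_def
  proof (rule finite_Lim_measure_decseq)
    show "decseq (\<lambda>n. {x \<in> space M. f x \<le> m + 1 / Suc n})"
      unfolding decseq_def
    proof (intro allI impI subsetI)
      fix k n x assume "k \<le> n" "x \<in> {x \<in> space M. f x \<le> m + 1 / Suc n}"
      with inv[of k n] show "x \<in> {x \<in> space M. f x \<le> m + 1 / Suc k}"
        by (auto simp del: of_nat_Suc)
    qed
  qed auto
  also have "(\<Inter>n. {x \<in> space M. f x \<le> m + 1 / Suc n}) = {x \<in> space M. f x \<le> m}"
  proof -
    have "y \<le> m" if "\<And>n. y \<le> m + 1 / Suc n" for y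
    proof (rule LIMSEQ_le_const[of "\<lambda>n. m + 1 / Suc n"])
      show "(\<lambda>n. m + 1 / Suc n) \<longlonglongrightarrow> m"
        using tendsto_add[OF tendsto_const LIMSEQ_inverse_real_of_nat, of m]
        by (simp add: inverse_eq_divide)
    qed (use that in auto)
    then show ?thesis
      by (auto intro: order_trans)
  qed
  finally have le: "T / 2 \<le> measure M {x \<in> space M. f x \<le> m}"
    using ge by (intro LIMSEQ_le_const) auto
  have "(\<lambda>n. F (m - 1 / Suc n)) \<longlonglongrightarrow> measure M (\<Union>n. {x \<in> space M. f x \<le> m - 1 / Suc n})"
    unfolding F_def
  proof (rule finite_Lim_measure_incseq)
    show "incseq (\<lambda>n. {x \<in> space M. f x \<le> m - 1 / Suc n})"
      unfolding incseq_def
    proof (intro allI impI subsetI)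
      fix k n x assume "k \<le> n" "x \<in> {x \<in> space M. f x \<le> m - 1 / Suc k}"
      with inv[of k n] show "x \<in> {x \<in> space M. f x \<le> m - 1 / Suc n}"
        by (auto simp del: of_nat_Suc)
    qed
  qed auto
  moreover have "(\<Union>n. {x \<in> space M. f x \<le> m - 1 / Suc n}) = space M - {x \<in> space M. m \<le> f x}"
  proof -
    have "\<exists>n. y \<le> m - 1 / Suc n" if "y < m" for y
    proof -
      obtain n where "1 / real (Suc n) < m - y"
        using reals_Archimedean[of "m - y"] \<open>y < m\<close> by (auto simp: inverse_eq_divide)
      then have "y \<le> m - 1 / Suc n"
        by linarith
      then show ?thesis ..
    qed
    moreover have "\<not> m \<le> y" if "y \<le> m - 1 / Suc n" for y n
      using that by (smt (verit) of_nat_0_less_iff zero_less_Suc zero_less_divide_1_iff)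
    ultimately have eq: "(\<exists>n. y \<le> m - 1 / Suc n) \<longleftrightarrow> \<not> m \<le> y" for y
      by (meson not_le)
    have "(\<Union>n. {x \<in> space M. f x \<le> m - 1 / Suc n}) = {x \<in> space M. \<exists>n. f x \<le> m - 1 / Suc n}"
      by auto
    then show ?thesis
      unfolding eq by auto
  qed
  ultimately have "measure M (space M - {x \<in> space M. m \<le> f x}) \<le> T / 2"
    using lt by (intro LIMSEQ_le_const2) auto
  then have "T - measure M {x \<in> space M. m \<le> f x} \<le> T / 2"
    by (subst (asm) finite_measure_compl) (auto simp: T_def)
  with le show thesis
    using that[of m] by (simp add: T_def)
qed

text \<open>
  A substitute for Hoelder's inequality in the situation where the \<open>p\<close>-th power integral of \<open>f\<close>
  is known to be at most \<open>\<Lambda> powr p * I\<close>, with \<open>I\<close> of the order of an area. It comes from integrating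
  \<open>y \<le> \<Lambda> + \<Lambda> powr (1 - p) * y powr p\<close>.
\<close>

lemma nn_integral_norm_le_powr:
  fixes f :: "'a \<Rightarrow> 'b :: real_normed_vector"
  assumes [measurable]: "(\<lambda>x. norm (f x)) \<in> borel_measurable M" "X \<in> sets M" and "1 < p" "0 < \<Lambda>"
    and le: "(\<integral>\<^sup>+x. ennreal (norm (f x) powr p) * indicator X x \<partial>M) \<le> ennreal (\<Lambda> powr p) * I"
  shows "(\<integral>\<^sup>+x. ennreal (norm (f x)) * indicator X x \<partial>M) \<le> ennreal \<Lambda> * (emeasure M X + I)"
proof -
  have pw: "y \<le> \<Lambda> + \<Lambda> powr (1 - p) * y powr p" if "0 \<le> y" for y
  proof (cases "y \<le> \<Lambda>")
    case True
    then show ?thesis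
      by (simp add: add_increasing2)
  next
    case False
    then have "y powr (1 - p) \<le> \<Lambda> powr (1 - p)"
      using \<open>1 < p\<close> \<open>0 < \<Lambda>\<close> by (intro powr_mono2') auto
    then have "y powr (1 - p) * y powr p \<le> \<Lambda> powr (1 - p) * y powr p"
      by (rule mult_right_mono) simp
    then show ?thesis
      using False \<open>0 < \<Lambda>\<close> by (simp add: powr_add[symmetric])
  qed
  have "(\<integral>\<^sup>+x. ennreal (norm (f x)) * indicator X x \<partial>M)
      \<le> (\<integral>\<^sup>+x. ennreal \<Lambda> * indicator X x
          + ennreal (\<Lambda> powr (1 - p)) * (ennreal (norm (f x) powr p) * indicator X x) \<partial>M)"
  proof (rule nn_integral_mono)
    fix x
    show "ennreal (norm (f x)) * indicator X x
      \<le> ennreal \<Lambda> * indicator X x + ennreal (\<Lambda> powr (1 - p)) * (ennreal (norm (f x) powr p) * indicator X x)"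
      using pw[of "norm (f x)"] \<open>0 < \<Lambda>\<close>
      by (cases "x \<in> X") (auto simp: ennreal_mult[symmetric] ennreal_plus[symmetric] simp del: ennreal_plus intro!: ennreal_leI)
  qed
  also have "\<dots> = ennreal \<Lambda> * emeasure M X
      + ennreal (\<Lambda> powr (1 - p)) * (\<integral>\<^sup>+x. ennreal (norm (f x) powr p) * indicator X x \<partial>M)"
    by (simp add: nn_integral_add nn_integral_cmult)
  also have "\<dots> \<le> ennreal \<Lambda> * emeasure M X + ennreal (\<Lambda> powr (1 - p)) * (ennreal (\<Lambda> powr p) * I)"
    by (intro add_left_mono mult_left_mono le) simp
  also have "ennreal (\<Lambda> powr (1 - p)) * (ennreal (\<Lambda> powr p) * I) = ennreal \<Lambda> * I"
    using \<open>0 < \<Lambda>\<close> by (simp add: mult.assoc[symmetric] ennreal_mult[symmetric] powr_add[symmetric])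
  finally show ?thesis
    by (simp add: distrib_left)
qed

text \<open>
  Splitting a nonnegative integrand into a signed integrable part and a nonnegative part whose
  integral may be infinite.
\<close>

lemma nn_integral_sum_le:
  fixes f g :: "'a \<Rightarrow> real"
  assumes f: "integrable M f" and "integral\<^sup>L M f \<le> r"
    and [measurable]: "g \<in> borel_measurable M"
    and "AE t in M. 0 \<le> g t" "AE t in M. 0 \<le> f t + g t" "0 \<le> r"
  shows "(\<integral>\<^sup>+t. ennreal (f t + g t) \<partial>M) \<le> ennreal r + (\<integral>\<^sup>+t. ennreal (g t) \<partial>M)"
proof (cases "(\<integral>\<^sup>+t. ennreal (g t) \<partial>M) = \<infinity>")
  case True
  then show ?thesis
    by simp
next
  case False
  have g: "integrable M g"
    using False assms by (intro integrableI_nonneg) (auto simp: less_top)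
  have "(\<integral>\<^sup>+t. ennreal (f t + g t) \<partial>M) = ennreal (integral\<^sup>L M f + integral\<^sup>L M g)"
    using f g assms by (subst nn_integral_eq_integral) auto
  also have "\<dots> \<le> ennreal (r + integral\<^sup>L M g)"
    using assms by (intro ennreal_leI) simp
  also have "\<dots> = ennreal r + (\<integral>\<^sup>+t. ennreal (g t) \<partial>M)"
    using assms g integral_nonneg_AE[of g M] by (subst nn_integral_eq_integral) auto
  finally show ?thesis .
qed

section \<open>From principal values to absolutely convergent integrals\<close>

lemma curve_measurable [measurable]: "curve \<beta>1 \<beta>2 \<in> borel_measurable borel"
  unfolding curve_def by measurable

text \<open>
  The Hilbert transform along the curve as an absolutely convergent integral. It agrees with the
  principal value at points \<open>x\<close> from which the support of \<open>f\<close> is not seen at small parameters.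
\<close>

definition curve_transform ::
  "real \<Rightarrow> real \<Rightarrow> (real \<times> real \<Rightarrow> complex) \<Rightarrow> real \<times> real \<Rightarrow> complex" where
  "curve_transform \<beta>1 \<beta>2 f x = (LINT t|lborel. hilbert_integrand \<beta>1 \<beta>2 f x t)"

lemma hilbert_integrand_measurable [measurable (raw)]:
  assumes [measurable]: "f \<in> borel_measurable borel" "g \<in> M \<rightarrow>\<^sub>M borel" "h \<in> borel_measurable M"
  shows "(\<lambda>y. hilbert_integrand \<beta>1 \<beta>2 f (g y) (h y)) \<in> borel_measurable M"
  unfolding hilbert_integrand_def by measurable

lemma curve_transform_measurable [measurable]:
  assumes [measurable]: "f \<in> borel_measurable borel"
  shows "curve_transform \<beta>1 \<beta>2 f \<in> borel_measurable borel"
  unfolding curve_transform_def by measurable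

lemma nn_integral_lborel_translate:
  fixes g :: "'a::euclidean_space \<Rightarrow> ennreal"
  assumes [measurable]: "g \<in> borel_measurable borel"
  shows "(\<integral>\<^sup>+x. g (x - c) \<partial>lborel) = (\<integral>\<^sup>+x. g x \<partial>lborel)"
proof -
  have "(\<integral>\<^sup>+x. g x \<partial>lborel) = (\<integral>\<^sup>+x. g x \<partial>distr lborel borel ((+) (- c)))"
    by (simp only: lborel_distr_plus)
  also have "\<dots> = (\<integral>\<^sup>+x. g (x - c) \<partial>lborel)"
    by (subst nn_integral_distr) simp_all
  finally show ?thesis ..
qed

text \<open>
  A property that holds almost everywhere in the plane holds almost everywhere on almost every
  translate of the curve: for each fixed \<open>t\<close> the map \<open>x \<mapsto> x - \<gamma> t\<close> is a translation, so
  Fubini's theorem applies. This allows \<open>b\<close> to be replaced by a Borel version although the curve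
  itself is a null set.
\<close>

lemma AE_along_curve:
  assumes "AE x in lborel. P (x :: real \<times> real)"
  shows "AE x in lborel. AE t in lborel. P (x - curve \<beta>1 \<beta>2 t)"
proof -
  obtain N where N: "N \<in> null_sets lborel" "{x. \<not> P x} \<subseteq> N"
    using assms unfolding eventually_ae_filter by auto
  then have [measurable]: "N \<in> sets borel"
    by auto
  have "AE x in lborel. x - curve \<beta>1 \<beta>2 t \<notin> N" for t
  proof -
    have "(\<integral>\<^sup>+x. indicator N (x - curve \<beta>1 \<beta>2 t) \<partial>lborel) = (0::ennreal)"
      using N by (subst nn_integral_lborel_translate[of "indicator N"]) auto
    then have "AE x in lborel. indicator N (x - curve \<beta>1 \<beta>2 t) = (0::ennreal)"
      by (subst (asm) nn_integral_0_iff_AE) measurable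
    then show ?thesis
      by eventually_elim (auto simp: indicator_def split: if_splits)
  qed
  then have "AE t in lborel. AE x in lborel. x - curve \<beta>1 \<beta>2 t \<notin> N"
    by simp
  then have "AE x in lborel. AE t in lborel. x - curve \<beta>1 \<beta>2 t \<notin> N"
    by (subst lborel_pair.AE_commute) measurable
  then show ?thesis
    by eventually_elim (use N in \<open>auto elim!: eventually_mono\<close>)
qed

text \<open>
  The truncated integrals do not depend on the truncation once it is below \<open>\<epsilon>0\<close>.
\<close>

lemma hilbert_off_support:
  assumes "0 < \<epsilon>0" and off: "\<And>t. \<bar>t\<bar> \<le> \<epsilon>0 \<Longrightarrow> f (x - curve \<beta>1 \<beta>2 t) = 0"
    and def: "hilbert_defined_at \<beta>1 \<beta>2 f x"
  shows "integrable lebesgue (hilbert_integrand \<beta>1 \<beta>2 f x)"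
    and "hilbert \<beta>1 \<beta>2 f x = (LINT t|lebesgue. hilbert_integrand \<beta>1 \<beta>2 f x t)"
proof -
  have ind: "indicator {t. \<epsilon> < \<bar>t\<bar>} t *\<^sub>R hilbert_integrand \<beta>1 \<beta>2 f x t = hilbert_integrand \<beta>1 \<beta>2 f x t"
    if "\<epsilon> < \<epsilon>0" for \<epsilon> t
    using that off[of t] by (auto simp: indicator_def hilbert_integrand_def)
  show "integrable lebesgue (hilbert_integrand \<beta>1 \<beta>2 f x)"
  proof -
    have "set_integrable lebesgue {t. \<epsilon>0 / 2 < \<bar>t\<bar>} (hilbert_integrand \<beta>1 \<beta>2 f x)"
      using def \<open>0 < \<epsilon>0\<close> unfolding hilbert_defined_at_def by (meson half_gt_zero)
    moreover have "(\<lambda>t. indicator {t. \<epsilon>0 / 2 < \<bar>t\<bar>} t *\<^sub>R hilbert_integrand \<beta>1 \<beta>2 f x t)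
        = hilbert_integrand \<beta>1 \<beta>2 f x"
      by (rule ext, rule ind) (use \<open>0 < \<epsilon>0\<close> in simp)
    ultimately show ?thesis
      unfolding set_integrable_def by (simp only:)
  qed
  have "eventually (\<lambda>\<epsilon>. \<epsilon> < \<epsilon>0) (at_right 0)"
    using \<open>0 < \<epsilon>0\<close> eventually_at_right by blast
  then have "eventually (\<lambda>\<epsilon>. trunc_hilbert \<beta>1 \<beta>2 \<epsilon> f x =
      (LINT t|lebesgue. hilbert_integrand \<beta>1 \<beta>2 f x t)) (at_right 0)"
    by eventually_elim (simp add: trunc_hilbert_def set_lebesgue_integral_def ind)
  then have "((\<lambda>\<epsilon>. trunc_hilbert \<beta>1 \<beta>2 \<epsilon> f x) \<longlongrightarrow>
      (LINT t|lebesgue. hilbert_integrand \<beta>1 \<beta>2 f x t)) (at_right 0)"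
    by (rule tendsto_eventually)
  then show "hilbert \<beta>1 \<beta>2 f x = (LINT t|lebesgue. hilbert_integrand \<beta>1 \<beta>2 f x t)"
    unfolding hilbert_def by (intro tendsto_Lim) auto
qed

text \<open>
  What the proof uses of the boundedness of the commutator: the inequality for Borel functions
  \<open>f\<close>, observed only on sets \<open>X\<close> from which the support of \<open>f\<close> is not seen at parameters
  \<open>\<bar>t\<bar> \<le> \<epsilon>\<close>, with all integrals absolutely convergent and taken with respect to Borel measure.
  The integrability clause is the part of the hypothesis that makes \<open>b * f\<close> meaningful along the
  curve when \<open>b\<close> is merely locally integrable.
\<close>

definition offdiag_bound :: "real \<Rightarrow> real \<Rightarrow> real \<Rightarrow> (real \<times> real \<Rightarrow> complex) \<Rightarrow> real \<Rightarrow> bool" where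
  "offdiag_bound \<beta>1 \<beta>2 p b \<Lambda> \<longleftrightarrow>
     (\<forall>f \<in> borel_measurable borel. \<forall>X \<in> sets borel. \<forall>\<epsilon>>0.
        bounded (range f) \<longrightarrow> bounded {x. f x \<noteq> 0} \<longrightarrow>
        (\<forall>x\<in>X. \<forall>t. \<bar>t\<bar> \<le> \<epsilon> \<longrightarrow> f (x - curve \<beta>1 \<beta>2 t) = 0) \<longrightarrow>
        (AE x in lborel. x \<in> X \<longrightarrow>
           integrable lborel (hilbert_integrand \<beta>1 \<beta>2 f x) \<and>
           integrable lborel (hilbert_integrand \<beta>1 \<beta>2 (\<lambda>y. b y * f y) x)) \<and>
        (\<integral>\<^sup>+x. ennreal (norm (b x * curve_transform \<beta>1 \<beta>2 f x
            - curve_transform \<beta>1 \<beta>2 (\<lambda>y. b y * f y) x) powr p) * indicator X x \<partial>lborel)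
        \<le> ennreal (\<Lambda> powr p) * (\<integral>\<^sup>+x. ennreal (norm (f x) powr p) \<partial>lborel))"

lemma locally_integrable_imp_measurable:
  assumes "locally_integrable b"
  shows "b \<in> borel_measurable lebesgue"
proof (rule borel_measurable_LIMSEQ_metric)
  show "(\<lambda>x. indicator (cball 0 (real n)) x *\<^sub>R b x) \<in> borel_measurable lebesgue" for n
    using assms unfolding locally_integrable_def set_integrable_def
    by (meson borel_measurable_integrable compact_cball)
  show "(\<lambda>n. indicator (cball 0 (real n)) x *\<^sub>R b x) \<longlonglongrightarrow> b x" for x
  proof (rule tendsto_eventually)
    show "\<forall>\<^sub>F n in sequentially. indicator (cball 0 (real n)) x *\<^sub>R b x = b x"
      using eventually_ge_at_top[of "nat \<lceil>norm x\<rceil>"]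
      by eventually_elim (auto simp: indicator_def)
  qed
qed

lemma ex_borel_version:
  fixes b :: "real \<times> real \<Rightarrow> complex"
  assumes [measurable]: "b \<in> borel_measurable lebesgue"
  obtains b' where "b' \<in> borel_measurable borel" "AE x in lborel. b x = b' x"
proof -
  have "(\<lambda>x. Re (b x)) \<in> borel_measurable lebesgue" "(\<lambda>x. Im (b x)) \<in> borel_measurable lebesgue"
    by measurable
  from this[THEN completion_ex_borel_measurable_real]
  obtain u v where [measurable]: "u \<in> borel_measurable lborel" "v \<in> borel_measurable lborel"
    and uv: "AE x in lborel. Re (b x) = u x" "AE x in lborel. Im (b x) = v x"
    by blast
  show thesis
  proof (rule that[of "\<lambda>x. Complex (u x) (v x)"])
    have "(\<lambda>x. complex_of_real (u x) + \<i> * complex_of_real (v x)) \<in> borel_measurable lborel"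
      by measurable
    then show "(\<lambda>x. Complex (u x) (v x)) \<in> borel_measurable borel"
      by (simp add: Complex_eq)
    show "AE x in lborel. b x = Complex (u x) (v x)"
      using uv by eventually_elim (simp add: complex_eq_iff)
  qed
qed

text \<open>
  Finiteness of the integral of \<open>f\<close> matters: it forces the integral of \<open>g\<close> to be finite, so that
  both norms are genuine \<open>p\<close>-th roots.
\<close>

lemma Lp_norm_le_imp_nn_integral_le:
  assumes p: "1 < p" and "0 < \<Lambda>"
    and fin: "(\<integral>\<^sup>+x. ennreal (norm (f x) powr p) \<partial>lborel) < \<infinity>"
    and le: "Lp_norm p g \<le> ennreal \<Lambda> * Lp_norm p f"
  shows "(\<integral>\<^sup>+x. ennreal (norm (g x) powr p) \<partial>lborel)
    \<le> ennreal (\<Lambda> powr p) * (\<integral>\<^sup>+x. ennreal (norm (f x) powr p) \<partial>lborel)"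
proof -
  define I where "I = (\<integral>\<^sup>+x. ennreal (norm (g x) powr p) \<partial>lborel)"
  define K where "K = (\<integral>\<^sup>+x. ennreal (norm (f x) powr p) \<partial>lborel)"
  obtain k where k: "K = ennreal k" "0 \<le> k"
    using fin unfolding K_def
    by (cases "\<integral>\<^sup>+x. ennreal (norm (f x) powr p) \<partial>lborel" rule: ennreal_cases) auto
  have "Lp_norm p f = ennreal (k powr (1/p))"
    using k by (simp add: Lp_norm_def nn_integral_completion K_def[symmetric])
  with le have le': "Lp_norm p g \<le> ennreal (\<Lambda> * k powr (1/p))"
    using \<open>0 < \<Lambda>\<close> by (simp add: ennreal_mult)
  then have "I \<noteq> \<infinity>"
    by (auto simp: Lp_norm_def nn_integral_completion I_def[symmetric] top_unique)
  then obtain i where i: "I = ennreal i" "0 \<le> i"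
    by (cases I rule: ennreal_cases) auto
  have "i powr (1/p) \<le> \<Lambda> * k powr (1/p)"
    using le' i k \<open>0 < \<Lambda>\<close> by (simp add: Lp_norm_def nn_integral_completion I_def[symmetric])
  then have "(i powr (1/p)) powr p \<le> (\<Lambda> * k powr (1/p)) powr p"
    using p by (intro powr_mono2) auto
  then have "i \<le> \<Lambda> powr p * k"
    using p i k \<open>0 < \<Lambda>\<close> by (simp add: powr_powr powr_mult)
  then show ?thesis
    using i k \<open>0 < \<Lambda>\<close> by (simp add: I_def[symmetric] K_def[symmetric] ennreal_mult[symmetric])
qed

lemma nn_integral_bounded_support_finite:
  fixes f :: "real \<times> real \<Rightarrow> complex"
  assumes "0 < p" "bounded (range f)" "bounded {x. f x \<noteq> 0}"
  shows "(\<integral>\<^sup>+x. ennreal (norm (f x) powr p) \<partial>lborel) < \<infinity>"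
proof -
  obtain B where B: "\<And>x. norm (f x) \<le> B"
    using assms(2) unfolding bounded_iff by auto
  obtain R where R: "\<And>x. f x \<noteq> 0 \<Longrightarrow> norm x \<le> R"
    using assms(3) unfolding bounded_iff by auto
  have "(\<integral>\<^sup>+x. ennreal (norm (f x) powr p) \<partial>lborel)
      \<le> (\<integral>\<^sup>+x. ennreal (B powr p) * indicator (cball (0 :: real \<times> real) R) x \<partial>lborel)"
  proof (rule nn_integral_mono)
    fix x
    show "ennreal (norm (f x) powr p) \<le> ennreal (B powr p) * indicator (cball 0 R) x"
      using B[of x] R[of x] \<open>0 < p\<close>
      by (cases "f x = 0") (auto intro!: ennreal_leI powr_mono2)
  qed
  also have "\<dots> < \<infinity>"
    by (subst nn_integral_cmult_indicator)
       (auto simp: ennreal_mult_less_top emeasure_lborel_cball_finite[unfolded infinity_ennreal_def])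
  finally show ?thesis .
qed

text \<open>
  At almost every \<open>x \<in> X\<close> the principal values converge by hypothesis and are absolutely
  convergent integrals by the support condition; along almost every translate of the curve, \<open>b\<close>
  may then be exchanged for its Borel version.
\<close>

lemma commutator_bound_imp_offdiag_bound:
  assumes p: "1 < p" and "0 < \<Lambda>" and bound: "commutator_bound \<beta>1 \<beta>2 p b (ennreal \<Lambda>)"
    and b': "b' \<in> borel_measurable borel" "AE x in lborel. b x = b' x"
  shows "offdiag_bound \<beta>1 \<beta>2 p b' \<Lambda>"
  unfolding offdiag_bound_def
proof (intro ballI allI impI)
  fix f :: "real \<times> real \<Rightarrow> complex" and X :: "(real \<times> real) set" and \<epsilon> :: real
  assume f: "f \<in> borel_measurable borel" and X: "X \<in> sets borel" and "0 < \<epsilon>"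
    and bdd: "bounded (range f)" "bounded {x. f x \<noteq> 0}"
    and off: "\<forall>x\<in>X. \<forall>t. \<bar>t\<bar> \<le> \<epsilon> \<longrightarrow> f (x - curve \<beta>1 \<beta>2 t) = 0"
  note [measurable] = b'(1) f X
  have "f \<in> bdd_compact_supp"
    using bdd f by (auto simp: bdd_compact_supp_def compact_closure measurable_completion)
  then have def: "AE x in lborel. commutator_defined_at \<beta>1 \<beta>2 b f x"
    and norm: "Lp_norm p (commutator \<beta>1 \<beta>2 b f) \<le> ennreal \<Lambda> * Lp_norm p f"
    using bound by (auto simp: commutator_bound_def AE_completion_iff)
  let ?bf = "\<lambda>y. b y * f y" and ?bf' = "\<lambda>y. b' y * f y"
  have key: "AE x in lborel. x \<in> X \<longrightarrow>
      integrable lborel (hilbert_integrand \<beta>1 \<beta>2 f x) \<and>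
      integrable lborel (hilbert_integrand \<beta>1 \<beta>2 ?bf' x) \<and>
      commutator \<beta>1 \<beta>2 b f x
        = b' x * curve_transform \<beta>1 \<beta>2 f x - curve_transform \<beta>1 \<beta>2 ?bf' x"
    using def AE_along_curve[OF b'(2), of \<beta>1 \<beta>2] b'(2)
  proof eventually_elim
    case (elim x)
    show ?case
    proof
      assume "x \<in> X"
      have m: "hilbert_integrand \<beta>1 \<beta>2 f x \<in> borel_measurable lborel"
        "hilbert_integrand \<beta>1 \<beta>2 ?bf' x \<in> borel_measurable lborel"
        by measurable
      have f1: "integrable lebesgue (hilbert_integrand \<beta>1 \<beta>2 f x)"
        "hilbert \<beta>1 \<beta>2 f x = (LINT t|lebesgue. hilbert_integrand \<beta>1 \<beta>2 f x t)"
        using elim(1) off \<open>x \<in> X\<close>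
        by (auto intro!: hilbert_off_support[OF \<open>0 < \<epsilon>\<close>] simp: commutator_defined_at_def)
      have f2: "integrable lebesgue (hilbert_integrand \<beta>1 \<beta>2 ?bf x)"
        "hilbert \<beta>1 \<beta>2 ?bf x = (LINT t|lebesgue. hilbert_integrand \<beta>1 \<beta>2 ?bf x t)"
        using elim(1) off \<open>x \<in> X\<close>
        by (auto intro!: hilbert_off_support[OF \<open>0 < \<epsilon>\<close>] simp: commutator_defined_at_def)
      have ae: "AE t in lebesgue. hilbert_integrand \<beta>1 \<beta>2 ?bf x t = hilbert_integrand \<beta>1 \<beta>2 ?bf' x t"
        unfolding AE_completion_iff using elim(2)
        by eventually_elim (simp add: hilbert_integrand_def)
      have "integrable lebesgue (hilbert_integrand \<beta>1 \<beta>2 ?bf' x)"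
        using f2(1) ae m(2)
        by (subst integrable_cong_AE[symmetric, where f="hilbert_integrand \<beta>1 \<beta>2 ?bf x"])
           (auto intro: measurable_completion)
      moreover have "hilbert \<beta>1 \<beta>2 ?bf x = (LINT t|lebesgue. hilbert_integrand \<beta>1 \<beta>2 ?bf' x t)"
        unfolding f2(2) using f2(1) ae m(2)
        by (intro integral_cong_AE) (auto intro: measurable_completion)
      ultimately show "integrable lborel (hilbert_integrand \<beta>1 \<beta>2 f x) \<and>
          integrable lborel (hilbert_integrand \<beta>1 \<beta>2 ?bf' x) \<and>
          commutator \<beta>1 \<beta>2 b f x
            = b' x * curve_transform \<beta>1 \<beta>2 f x - curve_transform \<beta>1 \<beta>2 ?bf' x"
        using f1 m elim(3)
        by (simp add: integrable_completion integral_completion commutator_def curve_transform_def)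
    qed
  qed
  have "(\<integral>\<^sup>+x. ennreal (norm (b' x * curve_transform \<beta>1 \<beta>2 f x
            - curve_transform \<beta>1 \<beta>2 ?bf' x) powr p) * indicator X x \<partial>lborel)
      \<le> (\<integral>\<^sup>+x. ennreal (norm (commutator \<beta>1 \<beta>2 b f x) powr p) \<partial>lborel)"
    by (intro nn_integral_mono_AE)
       (use key in eventually_elim, auto simp: indicator_def)
  also have "\<dots> \<le> ennreal (\<Lambda> powr p) * (\<integral>\<^sup>+x. ennreal (norm (f x) powr p) \<partial>lborel)"
    using p \<open>0 < \<Lambda>\<close> norm bdd
    by (intro Lp_norm_le_imp_nn_integral_le nn_integral_bounded_support_finite) auto
  finally show "(AE x in lborel. x \<in> X \<longrightarrow>
           integrable lborel (hilbert_integrand \<beta>1 \<beta>2 f x) \<and>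
           integrable lborel (hilbert_integrand \<beta>1 \<beta>2 ?bf' x)) \<and>
        (\<integral>\<^sup>+x. ennreal (norm (b' x * curve_transform \<beta>1 \<beta>2 f x
            - curve_transform \<beta>1 \<beta>2 ?bf' x) powr p) * indicator X x \<partial>lborel)
        \<le> ennreal (\<Lambda> powr p) * (\<integral>\<^sup>+x. ennreal (norm (f x) powr p) \<partial>lborel)"
    using key by auto
qed

text \<open>
  Multiplying \<open>b\<close> by a constant of modulus one leaves the size of its commutators unchanged. This
  passes from upper to lower estimates and from the real to the imaginary part.
\<close>

lemma offdiag_bound_unimodular:
  assumes "norm c = 1" "offdiag_bound \<beta>1 \<beta>2 p b \<Lambda>"
  shows "offdiag_bound \<beta>1 \<beta>2 p (\<lambda>x. c * b x) \<Lambda>"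
proof -
  have eq: "hilbert_integrand \<beta>1 \<beta>2 (\<lambda>y. c * b y * f y) x
      = (\<lambda>t. c * hilbert_integrand \<beta>1 \<beta>2 (\<lambda>y. b y * f y) x t)" for f x
    by (auto simp: hilbert_integrand_def)
  then have tr: "curve_transform \<beta>1 \<beta>2 (\<lambda>y. c * b y * f y) x
      = c * curve_transform \<beta>1 \<beta>2 (\<lambda>y. b y * f y) x" for f x
    unfolding curve_transform_def by simp
  have "c * b x * u - c * v = c * (b x * u - v)" for x u v
    by (simp add: algebra_simps)
  then have nm: "norm (c * b x * u - c * v) = norm (b x * u - v)" for x u v
    using assms(1) by (simp add: norm_mult)
  have "c \<noteq> 0"
    using assms(1) by auto
  then have int: "integrable lborel (\<lambda>t. c * g t) \<longleftrightarrow> integrable lborel g" for g :: "real \<Rightarrow> complex"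
    using integrable_mult_right[of "inverse c" lborel "\<lambda>t. c * g t"]
    by (auto simp: mult.assoc[symmetric])
  show ?thesis
    using assms(2) unfolding offdiag_bound_def eq tr nm int .
qed

section \<open>One-dimensional changes of variables\<close>

text \<open>
  Strict convexity of \<open>u powr \<alpha>\<close>: a sum of two such powers with fixed total \<open>q\<close> grows as the
  summands move apart. This is where \<open>\<beta>1 \<noteq> \<beta>2\<close> enters.
\<close>

lemma add_powr_strict_mono:
  fixes \<alpha> q u u' :: real
  assumes "1 < \<alpha>" "q / 2 \<le> u" "u < u'" "u' < q"
  shows "u powr \<alpha> + (q - u) powr \<alpha> < u' powr \<alpha> + (q - u') powr \<alpha>"
proof (rule DERIV_pos_imp_increasing_open[OF assms(3)])
  fix r assume r: "u < r" "r < u'"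
  then have "0 < q - r" "q - r < r"
    using assms by auto
  then have "((\<lambda>r. r powr \<alpha> + (q - r) powr \<alpha>) has_real_derivative
      \<alpha> * (r powr (\<alpha> - 1) - (q - r) powr (\<alpha> - 1))) (at r)"
    by (auto intro!: derivative_eq_intros simp: powr_diff algebra_simps)
  moreover have "0 < \<alpha> * (r powr (\<alpha> - 1) - (q - r) powr (\<alpha> - 1))"
    using assms \<open>0 < q - r\<close> \<open>q - r < r\<close> by (intro mult_pos_pos) (auto intro!: powr_less_mono2)
  ultimately show "\<exists>d. ((\<lambda>r. r powr \<alpha> + (q - r) powr \<alpha>) has_real_derivative d) (at r) \<and> 0 < d"
    by blast
next
  show "continuous_on {u..u'} (\<lambda>r. r powr \<alpha> + (q - r) powr \<alpha>)"
    using assms by (intro continuous_intros) auto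
qed

text \<open>
  For \<open>\<delta> = 0\<close> both inequalities are strict, being comparisons of the splittings \<open>9/4 + 3/4\<close>,
  \<open>2 + 1\<close> and \<open>7/4 + 5/4\<close> of \<open>3\<close>; by continuity they survive for small \<open>\<delta>\<close>. They say that the
  second coordinate of a sum of two points of the curve sweeps a whole interval of radius
  \<open>\<delta> powr \<alpha>\<close> about \<open>2 powr \<alpha> + 1\<close> when the first coordinate is fixed within \<open>\<delta>\<close> of \<open>3\<close> and
  its larger summand runs through \<open>[7/4, 9/4]\<close>; the first coordinates \<open>3 - \<delta>\<close> and \<open>3 + \<delta>\<close> are
  the worst cases.
\<close>

lemma ex_small_width:
  fixes \<alpha> :: real
  assumes "1 < \<alpha>"
  obtains \<delta> :: real where "0 < \<delta>" "\<delta> \<le> 1/4"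
    "2 powr \<alpha> + 1 + \<delta> powr \<alpha> \<le> (9/4) powr \<alpha> + (3/4 - \<delta>) powr \<alpha>"
    "(7/4) powr \<alpha> + (5/4 + \<delta>) powr \<alpha> \<le> 2 powr \<alpha> + 1 - \<delta> powr \<alpha>"
proof -
  have up: "2 powr \<alpha> + 1 < (9/4) powr \<alpha> + (3/4) powr \<alpha>"
    using add_powr_strict_mono[OF assms, of 3 2 "9/4"] by simp
  have lo: "(7/4) powr \<alpha> + (5/4) powr \<alpha> < 2 powr \<alpha> + 1"
    using add_powr_strict_mono[OF assms, of 3 "7/4" 2] by simp
  have pw: "((\<lambda>\<delta>. \<delta> powr \<alpha>) \<longlongrightarrow> 0) (at_right 0)"
    using assms by real_asymp
  have "((\<lambda>\<delta>. (9/4) powr \<alpha> + (3/4 - \<delta>) powr \<alpha> - \<delta> powr \<alpha>)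
      \<longlongrightarrow> (9/4) powr \<alpha> + (3/4 - 0) powr \<alpha> - 0) (at_right 0)"
    by (intro tendsto_intros pw) auto
  then have 1: "eventually (\<lambda>\<delta>. 2 powr \<alpha> + 1 < (9/4) powr \<alpha> + (3/4 - \<delta>) powr \<alpha> - \<delta> powr \<alpha>) (at_right 0)"
    using up by (intro order_tendstoD) auto
  have "((\<lambda>\<delta>. (7/4) powr \<alpha> + (5/4 + \<delta>) powr \<alpha> + \<delta> powr \<alpha>)
      \<longlongrightarrow> (7/4) powr \<alpha> + (5/4 + 0) powr \<alpha> + 0) (at_right 0)"
    by (intro tendsto_intros pw) auto
  then have 2: "eventually (\<lambda>\<delta>. (7/4) powr \<alpha> + (5/4 + \<delta>) powr \<alpha> + \<delta> powr \<alpha> < 2 powr \<alpha> + 1) (at_right 0)"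
    using lo by (intro order_tendstoD) auto
  have "eventually (\<lambda>\<delta>. \<delta> < (1/4::real)) (at_right 0)"
    by (rule eventually_at_right_real[of 0 "1/4", THEN eventually_mono]) auto
  with 1 2 have "eventually (\<lambda>\<delta>. 0 < \<delta> \<and> \<delta> \<le> 1/4 \<and>
      2 powr \<alpha> + 1 + \<delta> powr \<alpha> \<le> (9/4) powr \<alpha> + (3/4 - \<delta>) powr \<alpha> \<and>
      (7/4) powr \<alpha> + (5/4 + \<delta>) powr \<alpha> \<le> 2 powr \<alpha> + 1 - \<delta> powr \<alpha>) (at_right 0)"
    using eventually_at_right_less[of 0] by eventually_elim auto
  then show thesis
    using that eventually_happens'[OF trivial_limit_at_right_real] by blast
qed

lemma nn_integral_reflect:
  fixes g :: "real \<Rightarrow> ennreal"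
  assumes "g \<in> borel_measurable borel"
  shows "(\<integral>\<^sup>+v. g v \<partial>lborel) = (\<integral>\<^sup>+v. g (r - v) \<partial>lborel)"
  using nn_integral_real_affine[OF assms, of "-1" r] by simp

text \<open>
  Substituting \<open>u = t powr \<beta>1\<close> turns \<open>dt / t\<close> into \<open>du / (\<beta>1 * u)\<close>, and \<open>u \<le> B\<close> on the interval
  of integration.
\<close>

lemma nn_integral_along_curve:
  fixes g :: "real \<times> real \<Rightarrow> ennreal"
  assumes [measurable]: "g \<in> borel_measurable borel"
    and "0 < \<beta>1" "0 < A" "A < B"
  shows "(\<integral>\<^sup>+u. g (u, u powr (\<beta>2 / \<beta>1)) * indicator {A..B} u \<partial>lborel)
    \<le> ennreal (\<beta>1 * B) * (\<integral>\<^sup>+t. g (curve \<beta>1 \<beta>2 t) * ennreal (1 / t) \<partial>lborel)"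
proof -
  define s where "s r = r powr (1 / \<beta>1)" for r :: real
  have s: "0 < s A" "s A < s B" "s A powr \<beta>1 = A" "s B powr \<beta>1 = B"
    using assms by (auto simp: s_def powr_powr intro!: powr_less_mono2)
  have cont: "continuous_on {s A..s B} (\<lambda>t. \<beta>1 * t powr (\<beta>1 - 1))"
    using s by (intro continuous_intros) auto
  have "(\<integral>\<^sup>+u. g (u, u powr (\<beta>2 / \<beta>1)) * indicator {A..B} u \<partial>lborel)
      = (\<integral>\<^sup>+t. g (t powr \<beta>1, (t powr \<beta>1) powr (\<beta>2 / \<beta>1)) * ennreal (\<beta>1 * t powr (\<beta>1 - 1))
          * indicator {s A..s B} t \<partial>lborel)"
    using s assms cont
    by (subst nn_integral_substitution_aux[where g="\<lambda>t. t powr \<beta>1" and a="s A" and b="s B"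
          and g'="\<lambda>t. \<beta>1 * t powr (\<beta>1 - 1)" and f="\<lambda>u. g (u, u powr (\<beta>2 / \<beta>1))",
          unfolded s, symmetric])
       (auto intro!: derivative_eq_intros)
  also have "\<dots> \<le> (\<integral>\<^sup>+t. ennreal (\<beta>1 * B) * (g (curve \<beta>1 \<beta>2 t) * ennreal (1 / t)) \<partial>lborel)"
  proof (rule nn_integral_mono)
    fix t
    show "g (t powr \<beta>1, (t powr \<beta>1) powr (\<beta>2 / \<beta>1)) * ennreal (\<beta>1 * t powr (\<beta>1 - 1)) * indicator {s A..s B} t
        \<le> ennreal (\<beta>1 * B) * (g (curve \<beta>1 \<beta>2 t) * ennreal (1 / t))"
    proof (cases "t \<in> {s A..s B}")
      case True
      then have "0 < t" and tB: "t powr \<beta>1 \<le> B"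
        using s assms powr_mono2[of \<beta>1 t "s B"] by auto
      then have "\<beta>1 * t powr (\<beta>1 - 1) \<le> \<beta>1 * B * (1 / t)"
        using assms by (simp add: powr_diff field_simps)
      then have "ennreal (\<beta>1 * t powr (\<beta>1 - 1)) \<le> ennreal (\<beta>1 * B) * ennreal (1 / t)"
        using assms \<open>0 < t\<close> by (subst ennreal_mult[symmetric]) (auto intro!: ennreal_leI)
      then have "g (t powr \<beta>1, t powr \<beta>2) * ennreal (\<beta>1 * t powr (\<beta>1 - 1))
          \<le> g (t powr \<beta>1, t powr \<beta>2) * (ennreal (\<beta>1 * B) * ennreal (1 / t))"
        by (rule mult_left_mono) simp
      then show ?thesis
        using True \<open>0 < t\<close> assms by (simp add: curve_def powr_powr mult_ac)
    qed simp
  qed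
  also have "\<dots> = ennreal (\<beta>1 * B) * (\<integral>\<^sup>+t. g (curve \<beta>1 \<beta>2 t) * ennreal (1 / t) \<partial>lborel)"
    by (rule nn_integral_cmult) measurable
  finally show ?thesis .
qed

text \<open>
  The map \<open>u \<mapsto> u powr \<alpha> + (q - u) powr \<alpha>\<close> is increasing where \<open>u \<ge> q / 2\<close>, covers \<open>{y0..y1}\<close>, and
  has derivative at most \<open>\<alpha> * B powr (\<alpha> - 1)\<close>; hence the image of Lebesgue measure under it has a
  density bounded below on \<open>{y0..y1}\<close>. This is the Jacobian estimate of the two-step map, reduced
  to one variable.
\<close>

lemma nn_integral_add_powr:
  fixes g :: "real \<Rightarrow> ennreal"
  assumes [measurable]: "g \<in> borel_measurable borel"
    and "1 < \<alpha>" "0 < A" "A < B" "q \<le> 2 * A" "B < q"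
    and lo: "A powr \<alpha> + (q - A) powr \<alpha> \<le> y0" and hi: "y1 \<le> B powr \<alpha> + (q - B) powr \<alpha>"
  shows "(\<integral>\<^sup>+y. g y * indicator {y0..y1} y \<partial>lborel)
    \<le> ennreal (\<alpha> * B powr (\<alpha> - 1)) * (\<integral>\<^sup>+u. g (u powr \<alpha> + (q - u) powr \<alpha>) * indicator {A..B} u \<partial>lborel)"
proof -
  let ?\<phi> = "\<lambda>u. u powr \<alpha> + (q - u) powr \<alpha>"
  let ?\<phi>' = "\<lambda>u. \<alpha> * (u powr (\<alpha> - 1) - (q - u) powr (\<alpha> - 1))"
  have "(\<integral>\<^sup>+y. g y * indicator {y0..y1} y \<partial>lborel) \<le> (\<integral>\<^sup>+y. g y * indicator {?\<phi> A..?\<phi> B} y \<partial>lborel)"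
    using lo hi by (intro nn_integral_mono) (auto simp: indicator_def)
  also have "\<dots> = (\<integral>\<^sup>+u. g (?\<phi> u) * ennreal (?\<phi>' u) * indicator {A..B} u \<partial>lborel)"
  proof (rule nn_integral_substitution_aux)
    show "continuous_on {A..B} ?\<phi>'"
      using assms by (intro continuous_intros) auto
    fix u assume u: "u \<in> {A..B}"
    then show "(?\<phi> has_real_derivative ?\<phi>' u) (at u)"
      using assms by (auto intro!: derivative_eq_intros simp: powr_diff algebra_simps)
    show "0 \<le> ?\<phi>' u"
      using u assms by (auto intro!: mult_nonneg_nonneg powr_mono2)
  qed (use assms in auto)
  also have "\<dots> \<le> (\<integral>\<^sup>+u. ennreal (\<alpha> * B powr (\<alpha> - 1)) * (g (?\<phi> u) * indicator {A..B} u) \<partial>lborel)"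
  proof (rule nn_integral_mono)
    fix u
    show "g (?\<phi> u) * ennreal (?\<phi>' u) * indicator {A..B} u
        \<le> ennreal (\<alpha> * B powr (\<alpha> - 1)) * (g (?\<phi> u) * indicator {A..B} u)"
    proof (cases "u \<in> {A..B}")
      case True
      then have "u powr (\<alpha> - 1) \<le> B powr (\<alpha> - 1)"
        using assms by (intro powr_mono2) auto
      then have "?\<phi>' u \<le> \<alpha> * B powr (\<alpha> - 1)"
        using assms by (intro mult_left_mono) (auto intro: order_trans[rotated])
      then have "ennreal (?\<phi>' u) \<le> ennreal (\<alpha> * B powr (\<alpha> - 1))"
        by (rule ennreal_leI)
      then show ?thesis
        using True by (simp add: mult.commute[of "g _"] mult_right_mono)
    qed simp
  qed
  also have "\<dots> = ennreal (\<alpha> * B powr (\<alpha> - 1)) * (\<integral>\<^sup>+u. g (?\<phi> u) * indicator {A..B} u \<partial>lborel)"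
    by (rule nn_integral_cmult) measurable
  finally show ?thesis .
qed

section \<open>Three rectangles linked by two steps along the curve\<close>

text \<open>
  The width of the target rectangle is \<open>\<delta> * S\<close>, and \<open>S\<close> is the scale of the steps. The last two
  assumptions are those provided by the choice of a small \<open>\<delta>\<close>; the lower left corner of the
  target rectangle is \<open>(a, c)\<close>.
\<close>

locale two_step =
  fixes \<beta>1 \<beta>2 \<delta> S a c :: real
  assumes \<beta>: "0 < \<beta>1" "\<beta>1 < \<beta>2" and S: "0 < S" and \<delta>: "0 < \<delta>" "\<delta> \<le> 1/4"
    and upper: "2 powr (\<beta>2 / \<beta>1) + 1 + \<delta> powr (\<beta>2 / \<beta>1)
      \<le> (9/4) powr (\<beta>2 / \<beta>1) + (3/4 - \<delta>) powr (\<beta>2 / \<beta>1)"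
    and lower: "(7/4) powr (\<beta>2 / \<beta>1) + (5/4 + \<delta>) powr (\<beta>2 / \<beta>1)
      \<le> 2 powr (\<beta>2 / \<beta>1) + 1 - \<delta> powr (\<beta>2 / \<beta>1)"
begin

definition \<alpha> :: real where "\<alpha> = \<beta>2 / \<beta>1"

definition shift :: real where "shift = (2 powr \<alpha> + 1) * S powr \<alpha>"

definition near :: "(real \<times> real) set" where
  "near = {a..a + \<delta> * S} \<times> {c..c + (\<delta> * S) powr \<alpha>}"

definition far :: "(real \<times> real) set" where
  "far = {a + 3 * S..a + 3 * S + \<delta> * S} \<times> {c + shift..c + shift + (\<delta> * S) powr \<alpha>}"

text \<open>
  The horizontal extent of \<open>mid\<close> is that of the points \<open>x - \<gamma> t\<close> with \<open>x \<in> far\<close> and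
  \<open>t powr \<beta>1 \<in> {7/4 * S..9/4 * S}\<close>, since \<open>3 - 9/4 = 3/4\<close> and \<open>3 - 7/4 = 5/4\<close>. It alone keeps
  \<open>mid\<close> apart from \<open>near\<close> and \<open>far\<close>; vertically \<open>mid\<close> only has to be large enough to contain
  these points.
\<close>

definition mid :: "(real \<times> real) set" where
  "mid = {a + 3/4 * S..a + \<delta> * S + 5/4 * S}
     \<times> {c + shift - (9/4 * S) powr \<alpha>..c + shift + (\<delta> * S) powr \<alpha>}"

text \<open>
  Every step from \<open>far\<close> to \<open>mid\<close> or from \<open>mid\<close> to \<open>near\<close> has a horizontal component between
  \<open>S / 2\<close> and \<open>5/2 * S\<close>, hence a parameter between \<open>tmin\<close> and \<open>tmax\<close>.
\<close>

definition tmin :: real where "tmin = (S / 2) powr (1 / \<beta>1)"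

definition tmax :: real where "tmax = (5/2 * S) powr (1 / \<beta>1)"

lemma \<alpha>_gt_1: "1 < \<alpha>"
  using \<beta> by (simp add: \<alpha>_def)

lemma sets_rectangles [measurable]: "near \<in> sets borel" "mid \<in> sets borel" "far \<in> sets borel"
  unfolding near_def mid_def far_def by (auto intro!: borel_closed closed_Times)

lemma \<delta>S: "\<delta> * S \<le> S / 4"
  using S \<delta> by simp

lemma tmin_pos: "0 < tmin"
  using S by (simp add: tmin_def)

lemma time_window:
  assumes "S / 2 \<le> fst (curve \<beta>1 \<beta>2 t)" "fst (curve \<beta>1 \<beta>2 t) \<le> 5/2 * S"
  shows "t \<in> {tmin..tmax}"
proof -
  have "0 < \<bar>t\<bar> powr \<beta>1 * sgn t"
    using assms(1) S by (simp add: curve_def)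
  then have "0 < t"
    by (cases t "0::real" rule: linorder_cases) auto
  then have t: "S / 2 \<le> t powr \<beta>1" "t powr \<beta>1 \<le> 5/2 * S"
    using assms by (auto simp: curve_def)
  have "(S / 2) powr (1 / \<beta>1) \<le> (t powr \<beta>1) powr (1 / \<beta>1)"
    using t S \<beta> by (intro powr_mono2) auto
  moreover have "(t powr \<beta>1) powr (1 / \<beta>1) \<le> (5/2 * S) powr (1 / \<beta>1)"
    using t S \<beta> by (intro powr_mono2) auto
  ultimately show ?thesis
    using \<beta> \<open>0 < t\<close> by (simp add: powr_powr tmin_def tmax_def)
qed

lemma far_to_mid_time:
  assumes "x \<in> far" "x - curve \<beta>1 \<beta>2 t \<in> mid"
  shows "t \<in> {tmin..tmax}"
  using assms \<delta>S by (intro time_window) (auto simp: far_def mid_def mem_Times_iff)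

lemma mid_to_near_time:
  assumes "w \<in> mid" "w - curve \<beta>1 \<beta>2 t \<in> near"
  shows "t \<in> {tmin..tmax}"
  using assms \<delta>S by (intro time_window) (auto simp: near_def mid_def mem_Times_iff)

lemma far_to_mid:
  assumes "x \<in> far" "u \<in> {7/4 * S..9/4 * S}"
  shows "x - (u, u powr \<alpha>) \<in> mid"
proof -
  define r where "r = u powr \<alpha>"
  have "0 \<le> r" "r \<le> (9/4 * S) powr \<alpha>"
    using assms S \<alpha>_gt_1 by (auto simp: r_def intro!: powr_mono2)
  then show ?thesis
    using assms by (auto simp: far_def mid_def mem_Times_iff r_def[symmetric])
qed

lemma nn_integral_window_le:
  "(\<integral>\<^sup>+t. ennreal (1 / t) * indicator {tmin..tmax} t \<partial>lborel) \<le> ennreal (5 powr (1 / \<beta>1))"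
proof -
  have mm: "tmin \<le> tmax" "tmax = 5 powr (1 / \<beta>1) * tmin"
    using S \<beta> by (auto simp: tmin_def tmax_def powr_mult[symmetric] intro!: powr_mono2)
  have "(\<integral>\<^sup>+t. ennreal (1 / t) * indicator {tmin..tmax} t \<partial>lborel)
      \<le> (\<integral>\<^sup>+t. ennreal (1 / tmin) * indicator {tmin..tmax} t \<partial>lborel)"
    using tmin_pos by (intro nn_integral_mono) (auto simp: indicator_def frac_le intro!: ennreal_leI)
  also have "\<dots> = ennreal (1 / tmin) * ennreal (tmax - tmin)"
    using mm by (subst nn_integral_cmult_indicator) auto
  also have "\<dots> = ennreal ((tmax - tmin) / tmin)"
    using mm tmin_pos by (subst ennreal_mult[symmetric]) auto
  also have "\<dots> \<le> ennreal (5 powr (1 / \<beta>1))"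
    using mm tmin_pos by (intro ennreal_leI) (auto simp: field_simps)
  finally show ?thesis .
qed

text \<open>
  The reciprocal of the lower bound for the two-step kernel: one factor \<open>\<beta>1 * (5/2 * S)\<close> for each
  of the two measures \<open>dt / t\<close>, and the maximal Jacobian of the sum of two points of the curve.
\<close>

definition kernel_bound :: real where
  "kernel_bound = (\<beta>1 * (5/2 * S))\<^sup>2 * (\<alpha> * (9/4 * S) powr (\<alpha> - 1))"

text \<open>
  The inequalities satisfied by \<open>\<delta>\<close>, rescaled by \<open>S\<close> and extended from the worst cases to all
  horizontal displacements between \<open>near\<close> and \<open>far\<close>.
\<close>

lemma sum_of_steps_covers:
  assumes q: "q \<in> {3 * S - \<delta> * S..3 * S + \<delta> * S}"
  shows "(7/4 * S) powr \<alpha> + (q - 7/4 * S) powr \<alpha> \<le> shift - (\<delta> * S) powr \<alpha>"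
    and "shift + (\<delta> * S) powr \<alpha> \<le> (9/4 * S) powr \<alpha> + (q - 9/4 * S) powr \<alpha>"
proof -
  note lo = lower[folded \<alpha>_def] and up = upper[folded \<alpha>_def]
  have qb: "0 \<le> q - 7/4 * S" "q - 7/4 * S \<le> (5/4 + \<delta>) * S" "(3/4 - \<delta>) * S \<le> q - 9/4 * S"
    using q \<delta>S S unfolding atLeastAtMost_iff distrib_right left_diff_distrib by linarith+
  have "(q - 7/4 * S) powr \<alpha> \<le> ((5/4 + \<delta>) * S) powr \<alpha>"
    using qb \<alpha>_gt_1 by (intro powr_mono2) auto
  then have "(7/4 * S) powr \<alpha> + (q - 7/4 * S) powr \<alpha> \<le> ((7/4) powr \<alpha> + (5/4 + \<delta>) powr \<alpha>) * S powr \<alpha>"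
    unfolding powr_mult by (simp add: distrib_right)
  also have "\<dots> \<le> (2 powr \<alpha> + 1 - \<delta> powr \<alpha>) * S powr \<alpha>"
    using lo by (intro mult_right_mono) auto
  also have "\<dots> = shift - (\<delta> * S) powr \<alpha>"
    using S \<delta> by (simp add: shift_def powr_mult algebra_simps)
  finally show "(7/4 * S) powr \<alpha> + (q - 7/4 * S) powr \<alpha> \<le> shift - (\<delta> * S) powr \<alpha>" .
  have "((3/4 - \<delta>) * S) powr \<alpha> \<le> (q - 9/4 * S) powr \<alpha>"
    using qb S \<delta> \<alpha>_gt_1 by (intro powr_mono2) auto
  then have le: "((9/4) powr \<alpha> + (3/4 - \<delta>) powr \<alpha>) * S powr \<alpha> \<le> (9/4 * S) powr \<alpha> + (q - 9/4 * S) powr \<alpha>"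
    unfolding powr_mult by (simp add: distrib_right)
  have "shift + (\<delta> * S) powr \<alpha> = (2 powr \<alpha> + 1 + \<delta> powr \<alpha>) * S powr \<alpha>"
    using S \<delta> by (simp add: shift_def powr_mult algebra_simps)
  also have "\<dots> \<le> ((9/4) powr \<alpha> + (3/4 - \<delta>) powr \<alpha>) * S powr \<alpha>"
    using up by (intro mult_right_mono) auto
  finally show "shift + (\<delta> * S) powr \<alpha> \<le> (9/4 * S) powr \<alpha> + (q - 9/4 * S) powr \<alpha>"
    using le by simp
qed

text \<open>
  The two-step kernel on a vertical line: with the horizontal coordinates of \<open>x\<close> and \<open>z\<close>
  fixed, the total horizontal displacement \<open>q\<close> is fixed, and the horizontal part \<open>u\<close> of
  the first step is the remaining variable.
\<close>

lemma near_slice_le: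
  fixes G :: "real \<times> real \<Rightarrow> ennreal"
  assumes [measurable]: "G \<in> borel_measurable borel" and "x \<in> far" "z1 \<in> {a..a + \<delta> * S}"
  shows "(\<integral>\<^sup>+z2. G (z1, z2) * indicator {c..c + (\<delta> * S) powr \<alpha>} z2 \<partial>lborel)
    \<le> ennreal (\<alpha> * (9/4 * S) powr (\<alpha> - 1)) *
      (\<integral>\<^sup>+u. G (z1, snd x - u powr \<alpha> - (fst x - u - z1) powr \<alpha>) * indicator {7/4 * S..9/4 * S} u \<partial>lborel)"
proof -
  define q where "q = fst x - z1"
  have q: "q \<in> {3 * S - \<delta> * S..3 * S + \<delta> * S}"
    using assms by (auto simp: q_def far_def)
  have "(\<integral>\<^sup>+z2. G (z1, z2) * indicator {c..c + (\<delta> * S) powr \<alpha>} z2 \<partial>lborel)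
      = (\<integral>\<^sup>+y. G (z1, snd x - y) * indicator {c..c + (\<delta> * S) powr \<alpha>} (snd x - y) \<partial>lborel)"
    by (rule nn_integral_reflect) measurable
  also have "\<dots> \<le> (\<integral>\<^sup>+y. G (z1, snd x - y)
      * indicator {shift - (\<delta> * S) powr \<alpha>..shift + (\<delta> * S) powr \<alpha>} y \<partial>lborel)"
    using \<open>x \<in> far\<close> by (intro nn_integral_mono) (auto simp: indicator_def far_def)
  also have "\<dots> \<le> ennreal (\<alpha> * (9/4 * S) powr (\<alpha> - 1)) *
      (\<integral>\<^sup>+u. G (z1, snd x - (u powr \<alpha> + (q - u) powr \<alpha>)) * indicator {7/4 * S..9/4 * S} u \<partial>lborel)"
  proof (rule nn_integral_add_powr[OF _ \<alpha>_gt_1])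
    show "q \<le> 2 * (7/4 * S)" "9/4 * S < q"
      using q \<delta>S S unfolding atLeastAtMost_iff by linarith+
  qed (use S sum_of_steps_covers[OF q] in auto)
  finally show ?thesis
    by (simp add: q_def algebra_simps)
qed

text \<open>
  Writing both steps in the variables \<open>u\<close> and \<open>v\<close>, replace \<open>v\<close> by the horizontal coordinate
  \<open>z1 = fst x - u - v\<close> of the endpoint and exchange the integrals; what is left on each vertical
  line is the one-dimensional estimate above. The factor \<open>indicator mid\<close> is harmless because
  all steps with \<open>u \<in> {7/4 * S..9/4 * S}\<close> end in \<open>mid\<close>.
\<close>

lemma two_step_kernel_lower_bound:
  fixes G :: "real \<times> real \<Rightarrow> ennreal"
  assumes [measurable]: "G \<in> borel_measurable borel" and x: "x \<in> far"
  shows "(\<integral>\<^sup>+z. G z * indicator near z \<partial>lborel) \<le> ennreal kernel_bound *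
    (\<integral>\<^sup>+t. indicator mid (x - curve \<beta>1 \<beta>2 t)
       * (\<integral>\<^sup>+s. G (x - curve \<beta>1 \<beta>2 t - curve \<beta>1 \<beta>2 s) * ennreal (1 / s) \<partial>lborel)
       * ennreal (1 / t) \<partial>lborel)"
proof -
  obtain x1 x2 where x12: "x = (x1, x2)"
    by force
  let ?J = "{7/4 * S..9/4 * S}" and ?M = "ennreal (\<alpha> * (9/4 * S) powr (\<alpha> - 1))"
  let ?B = "ennreal (\<beta>1 * (5/2 * S))"
  let ?I1 = "indicator {a..a + \<delta> * S} :: real \<Rightarrow> ennreal"
  define inner where "inner w = (\<integral>\<^sup>+s. G (w - curve \<beta>1 \<beta>2 s) * ennreal (1 / s) \<partial>lborel)" for w
  have inner_meas [measurable]: "inner \<in> borel_measurable borel"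
    unfolding inner_def by measurable
  have inner_ge: "(\<integral>\<^sup>+z1. G (z1, x2 - u powr \<alpha> - (x1 - u - z1) powr \<alpha>) * ?I1 z1 \<partial>lborel)
      \<le> ?B * inner (x - (u, u powr \<alpha>))" if u: "u \<in> ?J" for u
  proof -
    have "(\<integral>\<^sup>+z1. G (z1, x2 - u powr \<alpha> - (x1 - u - z1) powr \<alpha>) * ?I1 z1 \<partial>lborel)
        = (\<integral>\<^sup>+v. G (x1 - u - v, x2 - u powr \<alpha> - (x1 - u - (x1 - u - v)) powr \<alpha>) * ?I1 (x1 - u - v) \<partial>lborel)"
      by (rule nn_integral_reflect) measurable
    also have "\<dots> \<le> (\<integral>\<^sup>+v. G (x - (u, u powr \<alpha>) - (v, v powr (\<beta>2 / \<beta>1))) * indicator {S/2..5/2 * S} v \<partial>lborel)"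
      using u x \<delta>S by (intro nn_integral_mono) (auto simp: indicator_def x12 far_def \<alpha>_def)
    also have "\<dots> \<le> ?B * inner (x - (u, u powr \<alpha>))"
      unfolding inner_def using \<beta> S
      by (intro nn_integral_along_curve[where g="\<lambda>y. G (x - (u, u powr \<alpha>) - y)"]) auto
    finally show ?thesis .
  qed
  have "(\<integral>\<^sup>+z. G z * indicator near z \<partial>lborel)
      = (\<integral>\<^sup>+z. G z * indicator near z \<partial>(lborel \<Otimes>\<^sub>M lborel))"
    by (simp add: lborel_prod)
  also have "\<dots> = (\<integral>\<^sup>+z1. (\<integral>\<^sup>+z2. G (z1, z2) * indicator near (z1, z2) \<partial>lborel) \<partial>lborel)"
    by (rule lborel.nn_integral_fst[symmetric]) (subst lborel_prod, measurable)
  also have "\<dots> = (\<integral>\<^sup>+z1. (\<integral>\<^sup>+z2. G (z1, z2)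
      * indicator {c..c + (\<delta> * S) powr \<alpha>} z2 \<partial>lborel) * ?I1 z1 \<partial>lborel)"
  proof (rule nn_integral_cong)
    fix z1
    show "(\<integral>\<^sup>+z2. G (z1, z2) * indicator near (z1, z2) \<partial>lborel)
      = (\<integral>\<^sup>+z2. G (z1, z2) * indicator {c..c + (\<delta> * S) powr \<alpha>} z2 \<partial>lborel) * ?I1 z1"
      by (cases "z1 \<in> {a..a + \<delta> * S}") (simp_all add: near_def indicator_times)
  qed
  also have "\<dots> \<le> (\<integral>\<^sup>+z1. ?M *
      (\<integral>\<^sup>+u. G (z1, x2 - u powr \<alpha> - (x1 - u - z1) powr \<alpha>) * indicator ?J u * ?I1 z1 \<partial>lborel) \<partial>lborel)"
    using near_slice_le[of G x] x
    by (intro nn_integral_mono) (auto simp: x12 indicator_def)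
  also have "\<dots> = ?M * (\<integral>\<^sup>+z1. (\<integral>\<^sup>+u. G (z1, x2 - u powr \<alpha> - (x1 - u - z1) powr \<alpha>)
        * indicator ?J u * ?I1 z1 \<partial>lborel) \<partial>lborel)"
    by (rule nn_integral_cmult) measurable
  also have "(\<integral>\<^sup>+z1. (\<integral>\<^sup>+u. G (z1, x2 - u powr \<alpha> - (x1 - u - z1) powr \<alpha>)
        * indicator ?J u * ?I1 z1 \<partial>lborel) \<partial>lborel)
      = (\<integral>\<^sup>+u. (\<integral>\<^sup>+z1. G (z1, x2 - u powr \<alpha> - (x1 - u - z1) powr \<alpha>)
        * indicator ?J u * ?I1 z1 \<partial>lborel) \<partial>lborel)"
    by (rule lborel_pair.Fubini') measurable
  also have "\<dots> \<le> (\<integral>\<^sup>+u. ?B * (indicator mid (x - (u, u powr (\<beta>2 / \<beta>1)))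
        * inner (x - (u, u powr (\<beta>2 / \<beta>1))) * indicator ?J u) \<partial>lborel)"
    using inner_ge far_to_mid[OF x]
    by (intro nn_integral_mono) (auto simp: indicator_def \<alpha>_def)
  also have "\<dots> = ?B * (\<integral>\<^sup>+u. indicator mid (x - (u, u powr (\<beta>2 / \<beta>1)))
        * inner (x - (u, u powr (\<beta>2 / \<beta>1))) * indicator ?J u \<partial>lborel)"
    by (rule nn_integral_cmult) measurable
  also have "\<dots> \<le> ?B * (?B * (\<integral>\<^sup>+t. indicator mid (x - curve \<beta>1 \<beta>2 t)
        * inner (x - curve \<beta>1 \<beta>2 t) * ennreal (1 / t) \<partial>lborel))"
  proof (rule mult_left_mono)
    let ?g = "\<lambda>y. indicator mid (x - y) * inner (x - y)"
    have "(\<integral>\<^sup>+u. ?g (u, u powr (\<beta>2 / \<beta>1)) * indicator ?J u \<partial>lborel)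
        \<le> (\<integral>\<^sup>+u. ?g (u, u powr (\<beta>2 / \<beta>1)) * indicator {S/2..5/2 * S} u \<partial>lborel)"
      using S by (intro nn_integral_mono) (auto simp: indicator_def)
    also have "\<dots> \<le> ?B * (\<integral>\<^sup>+t. ?g (curve \<beta>1 \<beta>2 t) * ennreal (1 / t) \<partial>lborel)"
      using \<beta> S by (intro nn_integral_along_curve) auto
    finally show "(\<integral>\<^sup>+u. ?g (u, u powr (\<beta>2 / \<beta>1)) * indicator ?J u \<partial>lborel)
        \<le> ?B * (\<integral>\<^sup>+t. ?g (curve \<beta>1 \<beta>2 t) * ennreal (1 / t) \<partial>lborel)" .
  qed simp
  finally have "(\<integral>\<^sup>+z. G z * indicator near z \<partial>lborel) \<le> ?M * (?B * (?B *
      (\<integral>\<^sup>+t. indicator mid (x - curve \<beta>1 \<beta>2 t) * inner (x - curve \<beta>1 \<beta>2 t) * ennreal (1 / t) \<partial>lborel)))"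
    by (simp add: mult_left_mono)
  moreover have "ennreal kernel_bound = ?M * (?B * ?B)"
    using \<beta> S \<alpha>_gt_1
    by (simp add: kernel_bound_def ennreal_mult[symmetric] power2_eq_square mult_ac)
  ultimately show ?thesis
    by (simp add: inner_def mult_ac)
qed

end

section \<open>The commutator along two steps\<close>

context two_step
begin

text \<open>
  The transform of the indicator of \<open>E\<close>, restricted to \<open>mid\<close>, as a real function. It is
  nonnegative because \<open>near\<close> is reached from \<open>mid\<close> at positive parameters only, and bounded
  because these parameters stay in \<open>{tmin..tmax}\<close>; so it is again an admissible test function.
\<close>

definition mass :: "(real \<times> real) set \<Rightarrow> real \<times> real \<Rightarrow> real" where
  "mass E w = indicator mid w * (LINT s|lborel. indicator E (w - curve \<beta>1 \<beta>2 s) / s)"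

lemma mass_measurable [measurable]:
  assumes [measurable]: "E \<in> sets borel"
  shows "mass E \<in> borel_measurable borel"
  unfolding mass_def by measurable

lemma hilbert_integrand_indicator:
  "hilbert_integrand \<beta>1 \<beta>2 (\<lambda>z. complex_of_real (indicator E z)) w s
    = complex_of_real (indicator E (w - curve \<beta>1 \<beta>2 s) / s)"
  by (simp add: hilbert_integrand_def)

lemma mass_eq_transform:
  assumes "w \<in> mid"
  shows "curve_transform \<beta>1 \<beta>2 (\<lambda>z. complex_of_real (indicator E z)) w = complex_of_real (mass E w)"
  using assms unfolding curve_transform_def hilbert_integrand_indicator mass_def
  by (simp del: of_real_divide)

lemma mass_off_mid: "w \<notin> mid \<Longrightarrow> mass E w = 0"
  by (simp add: mass_def)

lemma mass_bounds:
  assumes "E \<subseteq> near" and [measurable]: "E \<in> sets borel"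
  shows "0 \<le> mass E w" "mass E w \<le> 5 powr (1 / \<beta>1)"
proof -
  have "0 \<le> mass E w \<and> mass E w \<le> 5 powr (1 / \<beta>1)"
  proof (cases "w \<in> mid")
    case True
    have win: "s \<in> {tmin..tmax}" if "w - curve \<beta>1 \<beta>2 s \<in> E" for s
      using mid_to_near_time[OF True] that assms by auto
    have nn: "0 \<le> indicator E (w - curve \<beta>1 \<beta>2 s) / s" for s
      using win[of s] tmin_pos by (auto simp: indicator_def)
    have "ennreal (LINT s|lborel. indicator E (w - curve \<beta>1 \<beta>2 s) / s)
        \<le> (\<integral>\<^sup>+s. ennreal (indicator E (w - curve \<beta>1 \<beta>2 s) / s) \<partial>lborel)"
    proof (cases "integrable lborel (\<lambda>s. indicator E (w - curve \<beta>1 \<beta>2 s) / s)")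
      case True
      then show ?thesis
        using nn by (subst nn_integral_eq_integral) auto
    next
      case False
      then show ?thesis
        by (simp add: not_integrable_integral_eq)
    qed
    also have "\<dots> \<le> (\<integral>\<^sup>+s. ennreal (1 / s) * indicator {tmin..tmax} s \<partial>lborel)"
      using win by (intro nn_integral_mono) (auto simp: indicator_def)
    also have "\<dots> \<le> ennreal (5 powr (1 / \<beta>1))"
      by (rule nn_integral_window_le)
    finally have "(LINT s|lborel. indicator E (w - curve \<beta>1 \<beta>2 s) / s) \<le> 5 powr (1 / \<beta>1)"
      by simp
    then show ?thesis
      using True nn by (auto simp: mass_def intro!: Bochner_Integration.integral_nonneg)
  qed (simp add: mass_def)
  then show "0 \<le> mass E w" "mass E w \<le> 5 powr (1 / \<beta>1)"
    by auto
qed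

lemma bounded_rectangles: "bounded near" "bounded mid"
  unfolding near_def mid_def by (auto intro!: bounded_Times)

text \<open>
  The hypothesis for the step from \<open>mid\<close> to \<open>near\<close>: test function \<open>indicator E\<close>, observed on \<open>mid\<close>.
\<close>

lemma offdiag_bound_near:
  fixes E :: "(real \<times> real) set"
  assumes bd: "offdiag_bound \<beta>1 \<beta>2 p b \<Lambda>" and "0 < p" and E: "E \<subseteq> near" "E \<in> sets borel"
  defines "e \<equiv> \<lambda>z. complex_of_real (indicator E z)"
  shows "AE w in lborel. w \<in> mid \<longrightarrow> integrable lborel (hilbert_integrand \<beta>1 \<beta>2 e w) \<and>
      integrable lborel (hilbert_integrand \<beta>1 \<beta>2 (\<lambda>y. b y * e y) w)"
    and "(\<integral>\<^sup>+w. ennreal (norm (b w * curve_transform \<beta>1 \<beta>2 e w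
        - curve_transform \<beta>1 \<beta>2 (\<lambda>y. b y * e y) w) powr p) * indicator mid w \<partial>lborel)
      \<le> ennreal (\<Lambda> powr p) * emeasure lborel near"
proof -
  note [measurable] = E(2)
  have 1: "e \<in> borel_measurable borel"
    unfolding e_def by measurable
  have 2: "bounded (range e)"
    by (rule boundedI[of _ 1]) (auto simp: e_def indicator_def)
  have 3: "bounded {x. e x \<noteq> 0}"
    using E by (intro bounded_subset[OF bounded_rectangles(1)]) (auto simp: e_def indicator_def)
  have 4: "\<forall>w\<in>mid. \<forall>t. \<bar>t\<bar> \<le> tmin / 2 \<longrightarrow> e (w - curve \<beta>1 \<beta>2 t) = 0"
  proof (intro ballI allI impI)
    fix w t assume "w \<in> mid" "\<bar>t\<bar> \<le> tmin / 2"
    then show "e (w - curve \<beta>1 \<beta>2 t) = 0"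
      using mid_to_near_time[of w t] E tmin_pos by (auto simp: e_def indicator_def)
  qed
  have "0 < tmin / 2"
    using tmin_pos by simp
  note * = bd[unfolded offdiag_bound_def, rule_format, OF 1 sets_rectangles(2) this 2 3 4[rule_format]]
  then show "AE w in lborel. w \<in> mid \<longrightarrow> integrable lborel (hilbert_integrand \<beta>1 \<beta>2 e w) \<and>
      integrable lborel (hilbert_integrand \<beta>1 \<beta>2 (\<lambda>y. b y * e y) w)"
    by blast
  have "(\<integral>\<^sup>+x. ennreal (norm (e x) powr p) \<partial>lborel) \<le> (\<integral>\<^sup>+x. indicator near x \<partial>lborel)"
    using E \<open>0 < p\<close> by (intro nn_integral_mono) (auto simp: e_def indicator_def)
  then have "(\<integral>\<^sup>+x. ennreal (norm (e x) powr p) \<partial>lborel) \<le> emeasure lborel near"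
    by simp
  then show "(\<integral>\<^sup>+w. ennreal (norm (b w * curve_transform \<beta>1 \<beta>2 e w
        - curve_transform \<beta>1 \<beta>2 (\<lambda>y. b y * e y) w) powr p) * indicator mid w \<partial>lborel)
      \<le> ennreal (\<Lambda> powr p) * emeasure lborel near"
    by (intro order_trans[OF conjunct2[OF *] mult_left_mono]) auto
qed

text \<open>
  The hypothesis for the step from \<open>far\<close> to \<open>mid\<close>: test function \<open>mass E\<close>, observed on \<open>far\<close>.
\<close>

lemma offdiag_bound_far:
  fixes E :: "(real \<times> real) set"
  assumes bd: "offdiag_bound \<beta>1 \<beta>2 p b \<Lambda>" and "0 < p" and E: "E \<subseteq> near" "E \<in> sets borel"
  defines "h \<equiv> \<lambda>w. complex_of_real (mass E w)"
  shows "AE x in lborel. x \<in> far \<longrightarrow> integrable lborel (hilbert_integrand \<beta>1 \<beta>2 h x) \<and>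
      integrable lborel (hilbert_integrand \<beta>1 \<beta>2 (\<lambda>y. b y * h y) x)"
    and "(\<integral>\<^sup>+x. ennreal (norm (b x * curve_transform \<beta>1 \<beta>2 h x
        - curve_transform \<beta>1 \<beta>2 (\<lambda>y. b y * h y) x) powr p) * indicator far x \<partial>lborel)
      \<le> ennreal (\<Lambda> powr p) * (ennreal (5 powr (p / \<beta>1)) * emeasure lborel mid)"
proof -
  note [measurable] = E(2)
  have 1: "h \<in> borel_measurable borel"
    unfolding h_def by measurable
  have 2: "bounded (range h)"
    using mass_bounds[OF E] by (intro boundedI[of _ "5 powr (1 / \<beta>1)"]) (auto simp: h_def)
  have off: "h w = 0" if "w \<notin> mid" for w
    using that by (simp add: h_def mass_def)
  have 3: "bounded {x. h x \<noteq> 0}"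
    using off by (intro bounded_subset[OF bounded_rectangles(2)]) auto
  have 4: "\<forall>x\<in>far. \<forall>t. \<bar>t\<bar> \<le> tmin / 2 \<longrightarrow> h (x - curve \<beta>1 \<beta>2 t) = 0"
  proof (intro ballI allI impI)
    fix x t assume "x \<in> far" "\<bar>t\<bar> \<le> tmin / 2"
    then show "h (x - curve \<beta>1 \<beta>2 t) = 0"
      using far_to_mid_time[of x t] tmin_pos by (intro off) auto
  qed
  have "0 < tmin / 2"
    using tmin_pos by simp
  note * = bd[unfolded offdiag_bound_def, rule_format, OF 1 sets_rectangles(3) this 2 3 4[rule_format]]
  then show "AE x in lborel. x \<in> far \<longrightarrow> integrable lborel (hilbert_integrand \<beta>1 \<beta>2 h x) \<and>
      integrable lborel (hilbert_integrand \<beta>1 \<beta>2 (\<lambda>y. b y * h y) x)"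
    by blast
  have "(\<integral>\<^sup>+x. ennreal (norm (h x) powr p) \<partial>lborel)
      \<le> (\<integral>\<^sup>+x. ennreal (5 powr (p / \<beta>1)) * indicator mid x \<partial>lborel)"
  proof (rule nn_integral_mono)
    fix x
    have "norm (h x) powr p \<le> (5 powr (1 / \<beta>1)) powr p"
      using mass_bounds[OF E, of x] \<open>0 < p\<close> by (intro powr_mono2) (auto simp: h_def)
    then show "ennreal (norm (h x) powr p) \<le> ennreal (5 powr (p / \<beta>1)) * indicator mid x"
      using off[of x] by (cases "x \<in> mid") (auto simp: powr_powr intro!: ennreal_leI)
  qed
  also have "\<dots> = ennreal (5 powr (p / \<beta>1)) * emeasure lborel mid"
    by (rule nn_integral_cmult_indicator) simp
  finally show "(\<integral>\<^sup>+x. ennreal (norm (b x * curve_transform \<beta>1 \<beta>2 h x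
        - curve_transform \<beta>1 \<beta>2 (\<lambda>y. b y * h y) x) powr p) * indicator far x \<partial>lborel)
      \<le> ennreal (\<Lambda> powr p) * (ennreal (5 powr (p / \<beta>1)) * emeasure lborel mid)"
    by (intro order_trans[OF conjunct2[OF *] mult_left_mono]) auto
qed

text \<open>
  Subtracting \<open>m\<close> from \<open>Re b\<close> does not change the commutator, so for \<open>w \<in> mid\<close> the integral of the
  nonnegative function \<open>Re b - m\<close> over \<open>E\<close>, seen from \<open>w\<close>, equals
  \<open>(Re (b w) - m) * mass E w - Re A\<close>. The term \<open>(Re (b w) - m) * mass E w\<close> has no sign; it is kept
  and integrated in the next lemma.
\<close>

lemma mid_to_near_estimate:
  assumes w: "w \<in> mid" and E: "E \<subseteq> near" and above: "\<And>z. z \<in> E \<Longrightarrow> m \<le> Re (b z)"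
  defines "e \<equiv> \<lambda>z. complex_of_real (indicator E z)"
  assumes int: "integrable lborel (hilbert_integrand \<beta>1 \<beta>2 e w)"
      "integrable lborel (hilbert_integrand \<beta>1 \<beta>2 (\<lambda>y. b y * e y) w)"
  defines "A \<equiv> b w * curve_transform \<beta>1 \<beta>2 e w - curve_transform \<beta>1 \<beta>2 (\<lambda>y. b y * e y) w"
  shows "0 \<le> (Re (b w) - m) * mass E w + norm A"
    and "(\<integral>\<^sup>+s. ennreal (Re (b (w - curve \<beta>1 \<beta>2 s)) - m) * indicator E (w - curve \<beta>1 \<beta>2 s)
        * ennreal (1 / s) \<partial>lborel) \<le> ennreal ((Re (b w) - m) * mass E w + norm A)"
proof -
  define \<phi> where "\<phi> s = Re (hilbert_integrand \<beta>1 \<beta>2 (\<lambda>y. b y * e y) w s)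
      - m * Re (hilbert_integrand \<beta>1 \<beta>2 e w s)" for s
  have \<phi>: "integrable lborel \<phi>"
    unfolding \<phi>_def using int by auto
  have eq: "ennreal (Re (b (w - curve \<beta>1 \<beta>2 s)) - m) * indicator E (w - curve \<beta>1 \<beta>2 s) * ennreal (1 / s)
      = ennreal (\<phi> s) \<and> 0 \<le> \<phi> s" for s
  proof (cases "w - curve \<beta>1 \<beta>2 s \<in> E")
    case True
    then have "0 < s"
      using mid_to_near_time[OF w, of s] E tmin_pos by auto
    moreover have "\<phi> s = (Re (b (w - curve \<beta>1 \<beta>2 s)) - m) * (1 / s)"
      using True by (simp add: \<phi>_def hilbert_integrand_def e_def diff_divide_distrib)
    ultimately show ?thesis
      using True above[OF True] by (simp only: ennreal_mult') (simp add: ennreal_mult'[symmetric])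
  qed (simp add: \<phi>_def hilbert_integrand_def e_def)
  have "integral\<^sup>L lborel \<phi> = Re (curve_transform \<beta>1 \<beta>2 (\<lambda>y. b y * e y) w)
      - m * Re (curve_transform \<beta>1 \<beta>2 e w)"
    unfolding \<phi>_def curve_transform_def using int by simp
  also have "\<dots> = (Re (b w) - m) * mass E w - Re A"
    unfolding A_def using mass_eq_transform[OF w, of E] by (simp add: e_def algebra_simps)
  also have "\<dots> \<le> (Re (b w) - m) * mass E w + norm A"
    using abs_Re_le_cmod[of A] by linarith
  finally have le: "integral\<^sup>L lborel \<phi> \<le> (Re (b w) - m) * mass E w + norm A" .
  moreover have "0 \<le> integral\<^sup>L lborel \<phi>"
    using eq by (intro Bochner_Integration.integral_nonneg) auto
  ultimately show "0 \<le> (Re (b w) - m) * mass E w + norm A"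
    by simp
  have "(\<integral>\<^sup>+s. ennreal (Re (b (w - curve \<beta>1 \<beta>2 s)) - m) * indicator E (w - curve \<beta>1 \<beta>2 s)
        * ennreal (1 / s) \<partial>lborel) = (\<integral>\<^sup>+s. ennreal (\<phi> s) \<partial>lborel)"
    using eq by simp
  also have "\<dots> = ennreal (integral\<^sup>L lborel \<phi>)"
    using \<phi> eq by (intro nn_integral_eq_integral) auto
  also have "\<dots> \<le> ennreal ((Re (b w) - m) * mass E w + norm A)"
    by (rule ennreal_leI[OF le])
  finally show "(\<integral>\<^sup>+s. ennreal (Re (b (w - curve \<beta>1 \<beta>2 s)) - m) * indicator E (w - curve \<beta>1 \<beta>2 s)
        * ennreal (1 / s) \<partial>lborel) \<le> ennreal ((Re (b w) - m) * mass E w + norm A)" .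
qed

text \<open>
  Integrating the previous lemma over \<open>w = x - \<gamma> t\<close> against \<open>dt / t\<close>, the term with
  \<open>(Re (b w) - m) * mass E w\<close> becomes the real part of a transform of \<open>(b - m) * mass E\<close> at \<open>x\<close>.
  This equals \<open>(Re (b x) - m)\<close> times the nonnegative transform of \<open>mass E\<close>, minus \<open>Re A1\<close>, and
  the first of these two summands is at most \<open>0\<close>, since \<open>Re (b x) \<le> m\<close>.
\<close>

lemma far_to_near_estimate:
  assumes x: "x \<in> far" and E: "E \<subseteq> near" "E \<in> sets borel" and b: "b \<in> borel_measurable borel"
    and above: "\<And>z. z \<in> E \<Longrightarrow> m \<le> Re (b z)" and below: "Re (b x) \<le> m"
  defines "e \<equiv> \<lambda>z. complex_of_real (indicator E z)" and "h \<equiv> \<lambda>w. complex_of_real (mass E w)"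
  assumes int1: "AE t in lborel. x - curve \<beta>1 \<beta>2 t \<in> mid \<longrightarrow>
        integrable lborel (hilbert_integrand \<beta>1 \<beta>2 e (x - curve \<beta>1 \<beta>2 t)) \<and>
        integrable lborel (hilbert_integrand \<beta>1 \<beta>2 (\<lambda>y. b y * e y) (x - curve \<beta>1 \<beta>2 t))"
    and int2: "integrable lborel (hilbert_integrand \<beta>1 \<beta>2 h x)"
      "integrable lborel (hilbert_integrand \<beta>1 \<beta>2 (\<lambda>y. b y * h y) x)"
  defines "A1 \<equiv> b x * curve_transform \<beta>1 \<beta>2 h x - curve_transform \<beta>1 \<beta>2 (\<lambda>y. b y * h y) x"
    and "A2 \<equiv> \<lambda>w. b w * curve_transform \<beta>1 \<beta>2 e w - curve_transform \<beta>1 \<beta>2 (\<lambda>y. b y * e y) w"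
  shows "(\<integral>\<^sup>+t. indicator mid (x - curve \<beta>1 \<beta>2 t)
       * (\<integral>\<^sup>+s. ennreal (Re (b (x - curve \<beta>1 \<beta>2 t - curve \<beta>1 \<beta>2 s)) - m)
            * indicator E (x - curve \<beta>1 \<beta>2 t - curve \<beta>1 \<beta>2 s) * ennreal (1 / s) \<partial>lborel)
       * ennreal (1 / t) \<partial>lborel)
    \<le> ennreal (norm A1) + (\<integral>\<^sup>+t. indicator mid (x - curve \<beta>1 \<beta>2 t)
        * ennreal (norm (A2 (x - curve \<beta>1 \<beta>2 t))) * ennreal (1 / t) \<partial>lborel)"
proof -
  note [measurable] = b E(2)
  define w where "w t = x - curve \<beta>1 \<beta>2 t" for t
  have [measurable]: "w \<in> borel_measurable borel"
    unfolding w_def by measurable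
  have [measurable]: "e \<in> borel_measurable borel" "h \<in> borel_measurable borel"
    unfolding e_def h_def by measurable
  have [measurable]: "A2 \<in> borel_measurable borel"
    unfolding A2_def by measurable
  define f where "f t = Re (hilbert_integrand \<beta>1 \<beta>2 (\<lambda>y. b y * h y) x t)
      - m * Re (hilbert_integrand \<beta>1 \<beta>2 h x t)" for t
  define g where "g t = indicator mid (w t) * norm (A2 (w t)) * (1 / t)" for t
  \<comment> \<open>For \<open>t < 0\<close> the factor \<open>ennreal (1 / t)\<close> vanishes, but \<open>1 / t\<close> in \<open>g\<close> does
    not; the support in \<open>mid\<close> excludes such \<open>t\<close>.\<close>
  have win: "0 < t" if "w t \<in> mid" for t
    using far_to_mid_time[OF x, of t] that tmin_pos by (auto simp: w_def)
  have g_nonneg: "0 \<le> g t" for t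
    using win[of t] by (auto simp: g_def indicator_def)
  have g_eq: "ennreal (g t) = indicator mid (w t) * ennreal (norm (A2 (w t))) * ennreal (1 / t)" for t
    using win[of t] by (cases "w t \<in> mid") (auto simp: g_def ennreal_mult[symmetric])
  have f_eq: "f t = (Re (b (w t)) - m) * mass E (w t) * (1 / t)" for t
    by (simp add: f_def hilbert_integrand_def h_def w_def[symmetric] diff_divide_distrib left_diff_distrib)
  have f: "integrable lborel f"
    unfolding f_def using int2 by auto
  have T_h: "curve_transform \<beta>1 \<beta>2 h x = complex_of_real (LINT t|lborel. mass E (w t) / t)"
    by (simp add: curve_transform_def hilbert_integrand_def h_def w_def flip: of_real_divide)
  have "0 \<le> mass E (w t) / t" for t
    using win[of t] mass_bounds(1)[OF E, of "w t"] by (cases "w t \<in> mid") (auto simp: mass_off_mid)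
  then have T_h_nonneg: "0 \<le> (LINT t|lborel. mass E (w t) / t)"
    by (intro Bochner_Integration.integral_nonneg) auto
  have "integral\<^sup>L lborel f = Re (curve_transform \<beta>1 \<beta>2 (\<lambda>y. b y * h y) x)
      - m * Re (curve_transform \<beta>1 \<beta>2 h x)"
    unfolding f_def curve_transform_def using int2 by simp
  also have "\<dots> = (Re (b x) - m) * (LINT t|lborel. mass E (w t) / t) - Re A1"
    unfolding A1_def T_h by (simp add: algebra_simps)
  also have "\<dots> \<le> norm A1"
    using abs_Re_le_cmod[of A1] mult_nonpos_nonneg[OF _ T_h_nonneg, of "Re (b x) - m"] below by linarith
  finally have int_f: "integral\<^sup>L lborel f \<le> norm A1" .
  have key: "AE t in lborel. 0 \<le> f t + g t \<and> indicator mid (w t)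
       * (\<integral>\<^sup>+s. ennreal (Re (b (w t - curve \<beta>1 \<beta>2 s)) - m)
            * indicator E (w t - curve \<beta>1 \<beta>2 s) * ennreal (1 / s) \<partial>lborel)
       * ennreal (1 / t) \<le> ennreal (f t + g t)"
    using int1
  proof eventually_elim
    case (elim t)
    show ?case
    proof (cases "w t \<in> mid")
      case True
      have int: "integrable lborel (hilbert_integrand \<beta>1 \<beta>2 e (w t))"
        "integrable lborel (hilbert_integrand \<beta>1 \<beta>2 (\<lambda>y. b y * e y) (w t))"
        using elim True by (auto simp: w_def)
      have step: "0 \<le> (Re (b (w t)) - m) * mass E (w t) + norm (A2 (w t))"
        "(\<integral>\<^sup>+s. ennreal (Re (b (w t - curve \<beta>1 \<beta>2 s)) - m)
            * indicator E (w t - curve \<beta>1 \<beta>2 s) * ennreal (1 / s) \<partial>lborel)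
          \<le> ennreal ((Re (b (w t)) - m) * mass E (w t) + norm (A2 (w t)))"
        using mid_to_near_estimate[where b=b and m=m, OF True E(1) above int[unfolded e_def]]
        unfolding A2_def e_def by auto
      define V where "V = (Re (b (w t)) - m) * mass E (w t) + norm (A2 (w t))"
      have V: "0 \<le> V" "f t + g t = V / t"
        using True step(1) by (simp_all add: V_def f_eq g_def add_divide_distrib)
      have "(\<integral>\<^sup>+s. ennreal (Re (b (w t - curve \<beta>1 \<beta>2 s)) - m)
            * indicator E (w t - curve \<beta>1 \<beta>2 s) * ennreal (1 / s) \<partial>lborel) * ennreal (1 / t)
          \<le> ennreal V * ennreal (1 / t)"
        using step(2) by (intro mult_right_mono) (auto simp: V_def)
      also have "\<dots> = ennreal (V / t)"
        using V(1) win[OF True] by (simp flip: ennreal_mult)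
      finally show ?thesis
        using True V win[OF True] by simp
    next
      case False
      then show ?thesis
        by (simp add: f_eq g_def mass_def)
    qed
  qed
  have "(\<integral>\<^sup>+t. indicator mid (w t)
       * (\<integral>\<^sup>+s. ennreal (Re (b (w t - curve \<beta>1 \<beta>2 s)) - m)
            * indicator E (w t - curve \<beta>1 \<beta>2 s) * ennreal (1 / s) \<partial>lborel)
       * ennreal (1 / t) \<partial>lborel) \<le> (\<integral>\<^sup>+t. ennreal (f t + g t) \<partial>lborel)"
    by (intro nn_integral_mono_AE) (use key in eventually_elim, blast)
  also have "\<dots> \<le> ennreal (norm A1) + (\<integral>\<^sup>+t. ennreal (g t) \<partial>lborel)"
    using f int_f key g_nonneg
    by (intro nn_integral_sum_le) (auto simp: g_def[abs_def] elim: eventually_mono)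
  finally show ?thesis
    by (simp add: g_eq w_def)
qed

end

section \<open>Bounds for the oscillation\<close>

lemma emeasure_rectangle:
  fixes a b c d :: real
  assumes "a \<le> b" "c \<le> d"
  shows "emeasure lborel ({a..b} \<times> {c..d}) = ennreal ((b - a) * (d - c))"
  using assms
  by (subst lborel_prod[symmetric], subst lborel.emeasure_pair_measure_Times)
     (auto simp: ennreal_mult)

context two_step
begin

text \<open>
  The common area of \<open>near\<close> and \<open>far\<close>. The area of \<open>mid\<close> and \<open>kernel_bound\<close> are multiples of it by
  the constants \<open>mid_ratio\<close> and \<open>kernel_ratio\<close>, which depend on \<open>\<beta>1\<close>, \<open>\<beta>2\<close> and \<open>\<delta>\<close> but not
  on the scale \<open>S\<close>.
\<close>

definition vol :: real where "vol = (\<delta> * S) * (\<delta> * S) powr \<alpha>"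

definition mid_ratio :: real where
  "mid_ratio = (\<delta> powr \<alpha> + (9/4) powr \<alpha>) / (\<delta> * \<delta> powr \<alpha>)"

definition kernel_ratio :: real where
  "kernel_ratio = (5/2 * \<beta>1)\<^sup>2 * \<alpha> * (9/4) powr (\<alpha> - 1) / (\<delta> * \<delta> powr \<alpha>)"

definition osc_const :: "real \<Rightarrow> real" where
  "osc_const p = 2 * kernel_ratio * (1 + 5 powr (p / \<beta>1) * mid_ratio + 5 powr (1 / \<beta>1) * (mid_ratio + 1))"

lemma vol_pos: "0 < vol"
  using \<delta> S by (simp add: vol_def)

lemma mid_ratio_nonneg: "0 \<le> mid_ratio"
  using \<delta> by (simp add: mid_ratio_def)

lemma kernel_ratio_pos: "0 < kernel_ratio"
  using \<delta> \<beta> \<alpha>_gt_1 by (simp add: kernel_ratio_def)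

lemma osc_const_nonneg: "0 \<le> osc_const p"
  using mid_ratio_nonneg kernel_ratio_pos by (simp add: osc_const_def)

lemma emeasure_near: "emeasure lborel near = ennreal vol"
  using \<delta> S by (simp add: near_def emeasure_rectangle vol_def)

lemma emeasure_far: "emeasure lborel far = ennreal vol"
  using \<delta> S by (simp add: far_def emeasure_rectangle vol_def)

lemma emeasure_mid_le: "emeasure lborel mid \<le> ennreal (mid_ratio * vol)"
proof -
  have "0 < \<delta> * S"
    using \<delta> S by simp
  then have sides: "\<delta> * S + S / 2 \<le> S" "0 \<le> \<delta> * S + S / 2"
    using \<delta>S S by linarith+
  have heights: "0 \<le> (\<delta> * S) powr \<alpha> + (9/4 * S) powr \<alpha>"
    by simp
  have "emeasure lborel mid
      = ennreal ((a + \<delta> * S + 5/4 * S - (a + 3/4 * S))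
        * (c + shift + (\<delta> * S) powr \<alpha> - (c + shift - (9/4 * S) powr \<alpha>)))"
    unfolding mid_def
  proof (rule emeasure_rectangle)
    show "a + 3/4 * S \<le> a + \<delta> * S + 5/4 * S"
      using sides by linarith
    show "c + shift - (9/4 * S) powr \<alpha> \<le> c + shift + (\<delta> * S) powr \<alpha>"
      using heights by linarith
  qed
  also have "\<dots> = ennreal ((\<delta> * S + S / 2) * ((\<delta> * S) powr \<alpha> + (9/4 * S) powr \<alpha>))"
    by (rule arg_cong[where f=ennreal]) (simp add: algebra_simps)
  also have "\<dots> \<le> ennreal (S * ((\<delta> * S) powr \<alpha> + (9/4 * S) powr \<alpha>))"
    using sides heights by (intro ennreal_leI mult_right_mono) auto
  also have "S * ((\<delta> * S) powr \<alpha> + (9/4 * S) powr \<alpha>) = mid_ratio * vol"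
    using \<delta> S unfolding mid_ratio_def vol_def powr_mult by (simp add: field_simps)
  finally show ?thesis .
qed

lemma kernel_bound_eq: "kernel_bound = kernel_ratio * vol"
proof -
  have "S\<^sup>2 * S powr (\<alpha> - 1) = S * S powr \<alpha>"
    using S by (simp add: powr_diff power2_eq_square)
  then show ?thesis
    using \<delta> S unfolding kernel_bound_def kernel_ratio_def vol_def powr_mult power_mult_distrib
    by (simp add: field_simps)
qed

text \<open>
  Averaging over the steps from \<open>far\<close> to \<open>mid\<close> is bounded on integrals: by Fubini's theorem and
  translation invariance only the total weight of \<open>dt / t\<close> on \<open>{tmin..tmax}\<close> is lost.
\<close>

lemma mid_contribution_le:
  fixes A :: "real \<times> real \<Rightarrow> ennreal"
  assumes [measurable]: "A \<in> borel_measurable borel"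
  shows "(\<integral>\<^sup>+x. (\<integral>\<^sup>+t. indicator mid (x - curve \<beta>1 \<beta>2 t) * A (x - curve \<beta>1 \<beta>2 t)
        * ennreal (1 / t) \<partial>lborel) * indicator far x \<partial>lborel)
    \<le> ennreal (5 powr (1 / \<beta>1)) * (\<integral>\<^sup>+w. A w * indicator mid w \<partial>lborel)"
proof -
  have "(\<integral>\<^sup>+x. (\<integral>\<^sup>+t. indicator mid (x - curve \<beta>1 \<beta>2 t) * A (x - curve \<beta>1 \<beta>2 t)
        * ennreal (1 / t) \<partial>lborel) * indicator far x \<partial>lborel)
      \<le> (\<integral>\<^sup>+x. (\<integral>\<^sup>+t. A (x - curve \<beta>1 \<beta>2 t) * indicator mid (x - curve \<beta>1 \<beta>2 t)
        * (ennreal (1 / t) * indicator {tmin..tmax} t) \<partial>lborel) \<partial>lborel)"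
  proof (rule nn_integral_mono)
    fix x
    show "(\<integral>\<^sup>+t. indicator mid (x - curve \<beta>1 \<beta>2 t) * A (x - curve \<beta>1 \<beta>2 t)
          * ennreal (1 / t) \<partial>lborel) * indicator far x
        \<le> (\<integral>\<^sup>+t. A (x - curve \<beta>1 \<beta>2 t) * indicator mid (x - curve \<beta>1 \<beta>2 t)
          * (ennreal (1 / t) * indicator {tmin..tmax} t) \<partial>lborel)"
    proof (cases "x \<in> far")
      case True
      have "(\<integral>\<^sup>+t. indicator mid (x - curve \<beta>1 \<beta>2 t) * A (x - curve \<beta>1 \<beta>2 t) * ennreal (1 / t) \<partial>lborel)
          \<le> (\<integral>\<^sup>+t. A (x - curve \<beta>1 \<beta>2 t) * indicator mid (x - curve \<beta>1 \<beta>2 t)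
            * (ennreal (1 / t) * indicator {tmin..tmax} t) \<partial>lborel)"
        using far_to_mid_time[OF True] by (intro nn_integral_mono) (auto simp: indicator_def)
      then show ?thesis
        using True by simp
    qed simp
  qed
  also have "\<dots> = (\<integral>\<^sup>+t. (\<integral>\<^sup>+x. A (x - curve \<beta>1 \<beta>2 t) * indicator mid (x - curve \<beta>1 \<beta>2 t)
        * (ennreal (1 / t) * indicator {tmin..tmax} t) \<partial>lborel) \<partial>lborel)"
    by (rule lborel_pair.Fubini') measurable
  also have "\<dots> = (\<integral>\<^sup>+t. (\<integral>\<^sup>+w. A w * indicator mid w \<partial>lborel)
      * (ennreal (1 / t) * indicator {tmin..tmax} t) \<partial>lborel)"
    by (intro nn_integral_cong, subst nn_integral_multc)
       (auto simp: nn_integral_lborel_translate[of "\<lambda>w. A w * indicator mid w"])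
  also have "\<dots> = (\<integral>\<^sup>+w. A w * indicator mid w \<partial>lborel)
      * (\<integral>\<^sup>+t. ennreal (1 / t) * indicator {tmin..tmax} t \<partial>lborel)"
    by (rule nn_integral_cmult) measurable
  also have "\<dots> \<le> (\<integral>\<^sup>+w. A w * indicator mid w \<partial>lborel) * ennreal (5 powr (1 / \<beta>1))"
    by (intro mult_left_mono nn_integral_window_le) simp
  finally show ?thesis
    by (simp add: mult.commute)
qed

text \<open>
  For \<open>x \<in> F\<close> the pointwise estimate and the kernel bound control \<open>I\<close>, the integral to be bounded,
  by quantities depending on \<open>x\<close>. Integrating over \<open>F\<close> and using that \<open>F\<close> fills at least half of
  \<open>far\<close> gives \<open>I\<close> up to the area, while the right-hand side is controlled by the two
  instances of the commutator bound.
\<close>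

lemma one_sided_oscillation:
  assumes bd: "offdiag_bound \<beta>1 \<beta>2 p b \<Lambda>" and p: "1 < p" and "0 < \<Lambda>"
    and b: "b \<in> borel_measurable borel"
    and F: "F \<subseteq> far" "F \<in> sets borel" and half: "ennreal vol \<le> 2 * emeasure lborel F"
    and below: "\<And>x. x \<in> F \<Longrightarrow> Re (b x) \<le> m"
  shows "(\<integral>\<^sup>+z. ennreal (Re (b z) - m) * indicator near z \<partial>lborel) \<le> ennreal (osc_const p * \<Lambda> * vol)"
proof -
  note [measurable] = b F(2)
  define E where "E = {z \<in> near. m \<le> Re (b z)}"
  have E: "E \<subseteq> near" and [measurable]: "E \<in> sets borel"
    unfolding E_def by (auto intro: measurable_sets_borel)
  have above: "m \<le> Re (b z)" if "z \<in> E" for z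
    using that by (simp add: E_def)
  define e where "e = (\<lambda>z. complex_of_real (indicator E z))"
  define h where "h = (\<lambda>w. complex_of_real (mass E w))"
  have [measurable]: "e \<in> borel_measurable borel" "h \<in> borel_measurable borel"
    unfolding e_def h_def by measurable
  define A1 where "A1 x = b x * curve_transform \<beta>1 \<beta>2 h x - curve_transform \<beta>1 \<beta>2 (\<lambda>y. b y * h y) x" for x
  define A2 where "A2 w = b w * curve_transform \<beta>1 \<beta>2 e w - curve_transform \<beta>1 \<beta>2 (\<lambda>y. b y * e y) w" for w
  have [measurable]: "A1 \<in> borel_measurable borel" "A2 \<in> borel_measurable borel"
    unfolding A1_def A2_def by measurable
  define V where "V x = (\<integral>\<^sup>+t. indicator mid (x - curve \<beta>1 \<beta>2 t)
    * ennreal (norm (A2 (x - curve \<beta>1 \<beta>2 t))) * ennreal (1 / t) \<partial>lborel)" for x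
  have [measurable]: "V \<in> borel_measurable borel"
    unfolding V_def by measurable
  define I where "I = (\<integral>\<^sup>+z. ennreal (Re (b z) - m) * indicator near z \<partial>lborel)"
  define G where "G z = ennreal (Re (b z) - m) * indicator E z" for z
  have [measurable]: "G \<in> borel_measurable borel"
    unfolding G_def by measurable
  \<comment> \<open>\<open>ennreal\<close> cuts off negative values, so restricting to \<open>E\<close> loses nothing.\<close>
  have I_G: "I = (\<integral>\<^sup>+z. G z * indicator near z \<partial>lborel)"
    unfolding I_def G_def by (intro nn_integral_cong) (auto simp: E_def indicator_def ennreal_neg)

  have near_AE: "AE w in lborel. w \<in> mid \<longrightarrow> integrable lborel (hilbert_integrand \<beta>1 \<beta>2 e w) \<and>
      integrable lborel (hilbert_integrand \<beta>1 \<beta>2 (\<lambda>y. b y * e y) w)"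
    using offdiag_bound_near(1)[OF bd _ E] p unfolding e_def by simp
  have far_AE: "AE x in lborel. x \<in> far \<longrightarrow> integrable lborel (hilbert_integrand \<beta>1 \<beta>2 h x) \<and>
      integrable lborel (hilbert_integrand \<beta>1 \<beta>2 (\<lambda>y. b y * h y) x)"
    using offdiag_bound_far(1)[OF bd _ E] p unfolding h_def by simp
  have pointwise: "AE x in lborel. x \<in> F \<longrightarrow> I \<le> ennreal kernel_bound * (ennreal (norm (A1 x)) + V x)"
    using AE_along_curve[OF near_AE, of \<beta>1 \<beta>2] far_AE
  proof eventually_elim
    case (elim x)
    show ?case
    proof
      assume "x \<in> F"
      then have "x \<in> far"
        using F by auto
      have "I \<le> ennreal kernel_bound * (\<integral>\<^sup>+t. indicator mid (x - curve \<beta>1 \<beta>2 t)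
         * (\<integral>\<^sup>+s. G (x - curve \<beta>1 \<beta>2 t - curve \<beta>1 \<beta>2 s) * ennreal (1 / s) \<partial>lborel)
         * ennreal (1 / t) \<partial>lborel)"
        unfolding I_G by (rule two_step_kernel_lower_bound[OF _ \<open>x \<in> far\<close>]) measurable
      also have "\<dots> \<le> ennreal kernel_bound * (ennreal (norm (A1 x)) + V x)"
        unfolding G_def V_def A1_def A2_def e_def h_def
        using elim \<open>x \<in> far\<close> below[OF \<open>x \<in> F\<close>] above E unfolding e_def h_def
        by (intro mult_left_mono far_to_near_estimate) (auto simp: E)
      finally show "I \<le> ennreal kernel_bound * (ennreal (norm (A1 x)) + V x)" .
    qed
  qed

  have A1_le: "(\<integral>\<^sup>+x. ennreal (norm (A1 x)) * indicator far x \<partial>lborel)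
      \<le> ennreal (\<Lambda> * (vol + 5 powr (p / \<beta>1) * (mid_ratio * vol)))"
  proof -
    have "(\<integral>\<^sup>+x. ennreal (norm (A1 x)) * indicator far x \<partial>lborel)
        \<le> ennreal \<Lambda> * (emeasure lborel far + ennreal (5 powr (p / \<beta>1)) * emeasure lborel mid)"
      using offdiag_bound_far(2)[OF bd _ E] p \<open>0 < \<Lambda>\<close>
      by (intro nn_integral_norm_le_powr[where p=p]) (auto simp: A1_def h_def)
    also have "\<dots> \<le> ennreal \<Lambda> * (ennreal vol + ennreal (5 powr (p / \<beta>1)) * ennreal (mid_ratio * vol))"
      unfolding emeasure_far using emeasure_mid_le
      by (intro mult_left_mono add_left_mono) auto
    also have "\<dots> = ennreal (\<Lambda> * (vol + 5 powr (p / \<beta>1) * (mid_ratio * vol)))"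
      using vol_pos mid_ratio_nonneg \<open>0 < \<Lambda>\<close> by (simp add: ennreal_mult)
    finally show ?thesis .
  qed
  have V_le: "(\<integral>\<^sup>+x. V x * indicator far x \<partial>lborel)
      \<le> ennreal (5 powr (1 / \<beta>1) * (\<Lambda> * (mid_ratio * vol + vol)))"
  proof -
    have "(\<integral>\<^sup>+x. V x * indicator far x \<partial>lborel)
        \<le> ennreal (5 powr (1 / \<beta>1)) * (\<integral>\<^sup>+w. ennreal (norm (A2 w)) * indicator mid w \<partial>lborel)"
      unfolding V_def by (rule mid_contribution_le) measurable
    also have "\<dots> \<le> ennreal (5 powr (1 / \<beta>1)) * (ennreal \<Lambda> * (emeasure lborel mid + emeasure lborel near))"
      using offdiag_bound_near(2)[OF bd _ E] p \<open>0 < \<Lambda>\<close>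
      by (intro mult_left_mono nn_integral_norm_le_powr[where p=p]) (auto simp: A2_def e_def)
    also have "\<dots> \<le> ennreal (5 powr (1 / \<beta>1)) * (ennreal \<Lambda> * (ennreal (mid_ratio * vol) + ennreal vol))"
      unfolding emeasure_near using emeasure_mid_le
      by (intro mult_left_mono add_right_mono) auto
    also have "\<dots> = ennreal (5 powr (1 / \<beta>1) * (\<Lambda> * (mid_ratio * vol + vol)))"
      using vol_pos mid_ratio_nonneg \<open>0 < \<Lambda>\<close> by (simp add: ennreal_mult)
    finally show ?thesis .
  qed

  have "I * emeasure lborel F = (\<integral>\<^sup>+x. I * indicator F x \<partial>lborel)"
    by (simp add: nn_integral_cmult)
  also have "\<dots> \<le> (\<integral>\<^sup>+x. ennreal kernel_bound *
      (ennreal (norm (A1 x)) * indicator far x + V x * indicator far x) \<partial>lborel)"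
    by (intro nn_integral_mono_AE)
       (use pointwise in eventually_elim, use F in \<open>auto simp: indicator_def\<close>)
  also have "\<dots> = ennreal kernel_bound * ((\<integral>\<^sup>+x. ennreal (norm (A1 x)) * indicator far x \<partial>lborel)
      + (\<integral>\<^sup>+x. V x * indicator far x \<partial>lborel))"
    by (subst nn_integral_cmult, measurable) (subst nn_integral_add, measurable)
  also have "\<dots> \<le> ennreal kernel_bound * (ennreal (\<Lambda> * (vol + 5 powr (p / \<beta>1) * (mid_ratio * vol)))
      + ennreal (5 powr (1 / \<beta>1) * (\<Lambda> * (mid_ratio * vol + vol))))"
    by (intro mult_left_mono add_mono A1_le V_le) simp
  also have "\<dots> = ennreal (osc_const p * \<Lambda> * vol * (vol / 2))"
  proof -
    let ?P = "\<Lambda> * (vol + 5 powr (p / \<beta>1) * (mid_ratio * vol))"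
    let ?Q = "5 powr (1 / \<beta>1) * (\<Lambda> * (mid_ratio * vol + vol))"
    have nonneg: "0 \<le> ?P" "0 \<le> ?Q" "0 \<le> kernel_bound"
      using vol_pos mid_ratio_nonneg kernel_ratio_pos \<open>0 < \<Lambda>\<close> by (simp_all add: kernel_bound_eq)
    have "kernel_bound * (?P + ?Q) = osc_const p * \<Lambda> * vol * (vol / 2)"
      by (simp add: kernel_bound_eq osc_const_def algebra_simps)
    then show ?thesis
      by (simp only: ennreal_plus[OF nonneg(1,2), symmetric]
          ennreal_mult[OF nonneg(3) add_nonneg_nonneg[OF nonneg(1,2)], symmetric])
  qed
  finally have *: "I * emeasure lborel F \<le> ennreal (osc_const p * \<Lambda> * vol * (vol / 2))" .
  have "I * ennreal vol \<le> I * (2 * emeasure lborel F)"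
    by (intro mult_left_mono half) simp
  also have "\<dots> \<le> 2 * ennreal (osc_const p * \<Lambda> * vol * (vol / 2))"
    using mult_left_mono[OF *, of 2] by (simp add: mult_ac)
  also have "\<dots> = ennreal (osc_const p * \<Lambda> * vol * vol)"
    using osc_const_nonneg[of p] vol_pos \<open>0 < \<Lambda>\<close>
    by (simp add: ennreal_mult[of 2, symmetric, simplified] flip: ennreal_numeral ennreal_mult)
  finally have "I * ennreal vol \<le> ennreal (osc_const p * \<Lambda> * vol * vol)" .
  then have "I \<le> ennreal (osc_const p * \<Lambda> * vol)"
    using vol_pos osc_const_nonneg[of p] \<open>0 < \<Lambda>\<close>
    by (cases I rule: ennreal_cases)
       (auto simp: ennreal_mult_top ennreal_top_mult top_unique simp flip: ennreal_mult)
  then show ?thesis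
    by (simp add: I_def)
qed

text \<open>
  With \<open>m\<close> a median of \<open>Re b\<close> on \<open>far\<close>, the one-sided estimate applies both to \<open>b\<close> with level \<open>m\<close>
  and to \<open>- b\<close> with level \<open>- m\<close>.
\<close>

lemma real_part_oscillation:
  assumes bd: "offdiag_bound \<beta>1 \<beta>2 p b \<Lambda>" and p: "1 < p" and "0 < \<Lambda>"
    and b: "b \<in> borel_measurable borel"
  obtains m where "(\<integral>\<^sup>+z. ennreal \<bar>Re (b z) - m\<bar> * indicator near z \<partial>lborel)
    \<le> ennreal (2 * osc_const p * \<Lambda> * vol)"
proof -
  note [measurable] = b
  let ?M = "restrict_space lborel far"
  interpret finite_measure ?M
    by (rule finite_measureI) (simp add: space_restrict_space emeasure_restrict_space emeasure_far)
  have "(\<lambda>x. Re (b x)) \<in> borel_measurable ?M"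
    by (intro measurable_restrict_space1) measurable
  then obtain m where m: "measure ?M (space ?M) \<le> 2 * measure ?M {x \<in> space ?M. Re (b x) \<le> m}"
    "measure ?M (space ?M) \<le> 2 * measure ?M {x \<in> space ?M. m \<le> Re (b x)}"
    by (rule ex_median)
  have em: "ennreal vol \<le> 2 * emeasure lborel F"
    if F: "F \<subseteq> far" "F \<in> sets borel" "measure ?M (space ?M) \<le> 2 * measure ?M F" for F
  proof -
    have fin: "emeasure lborel F \<noteq> \<infinity>"
      using emeasure_mono[of F far lborel] F by (auto simp: emeasure_far top_unique)
    have "vol \<le> 2 * measure lborel F"
      using F vol_pos measure_eq_emeasure_eq_ennreal[OF _ emeasure_far]
      by (simp add: space_restrict_space measure_restrict_space)
    then have "ennreal vol \<le> ennreal (2 * measure lborel F)"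
      by (rule ennreal_leI)
    then show ?thesis
      using fin by (simp add: ennreal_mult emeasure_eq_ennreal_measure)
  qed
  have Fs: "{x \<in> far. Re (b x) \<le> m} \<in> sets borel" "{x \<in> far. m \<le> Re (b x)} \<in> sets borel"
    by measurable
  have up: "(\<integral>\<^sup>+z. ennreal (Re (b z) - m) * indicator near z \<partial>lborel) \<le> ennreal (osc_const p * \<Lambda> * vol)"
    using m Fs by (intro one_sided_oscillation[OF bd p \<open>0 < \<Lambda>\<close> b _ _ em]) (auto simp: space_restrict_space)
  have bd': "offdiag_bound \<beta>1 \<beta>2 p (\<lambda>x. - 1 * b x) \<Lambda>"
    by (rule offdiag_bound_unimodular[OF _ bd]) simp
  have down: "(\<integral>\<^sup>+z. ennreal (Re (- 1 * b z) - (- m)) * indicator near z \<partial>lborel)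
      \<le> ennreal (osc_const p * \<Lambda> * vol)"
    using m Fs
    by (intro one_sided_oscillation[OF bd' p \<open>0 < \<Lambda>\<close> _ _ _ em, where F="{x \<in> far. m \<le> Re (b x)}"])
       (auto simp: space_restrict_space)
  have "ennreal \<bar>y\<bar> = ennreal y + ennreal (- y)" for y
    by (cases "0 \<le> y") (auto simp: ennreal_neg)
  then have "(\<integral>\<^sup>+z. ennreal \<bar>Re (b z) - m\<bar> * indicator near z \<partial>lborel)
      = (\<integral>\<^sup>+z. ennreal (Re (b z) - m) * indicator near z
          + ennreal (Re (- 1 * b z) - (- m)) * indicator near z \<partial>lborel)"
    by (intro nn_integral_cong) (simp add: distrib_right)
  also have "\<dots> = (\<integral>\<^sup>+z. ennreal (Re (b z) - m) * indicator near z \<partial>lborel)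
      + (\<integral>\<^sup>+z. ennreal (Re (- 1 * b z) - (- m)) * indicator near z \<partial>lborel)"
    by (rule nn_integral_add) measurable
  also have "\<dots> \<le> ennreal (osc_const p * \<Lambda> * vol) + ennreal (osc_const p * \<Lambda> * vol)"
    using up down by (rule add_mono)
  also have "\<dots> = ennreal (2 * osc_const p * \<Lambda> * vol)"
    using osc_const_nonneg[of p] vol_pos \<open>0 < \<Lambda>\<close> by (simp flip: ennreal_plus)
  finally show thesis
    by (rule that)
qed

text \<open>
  The imaginary part of \<open>b\<close> is the real part of \<open>- \<i> * b\<close>.
\<close>

lemma complex_oscillation:
  assumes bd: "offdiag_bound \<beta>1 \<beta>2 p b \<Lambda>" and p: "1 < p" and "0 < \<Lambda>"
    and b: "b \<in> borel_measurable borel"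
  obtains \<mu> where "(\<integral>\<^sup>+z. ennreal (norm (b z - \<mu>)) * indicator near z \<partial>lborel)
    \<le> ennreal (4 * osc_const p * \<Lambda> * vol)"
proof -
  note [measurable] = b
  obtain m where m: "(\<integral>\<^sup>+z. ennreal \<bar>Re (b z) - m\<bar> * indicator near z \<partial>lborel)
      \<le> ennreal (2 * osc_const p * \<Lambda> * vol)"
    using real_part_oscillation[OF assms] .
  have bd': "offdiag_bound \<beta>1 \<beta>2 p (\<lambda>x. - \<i> * b x) \<Lambda>"
    by (rule offdiag_bound_unimodular[OF _ bd]) simp
  obtain n where n: "(\<integral>\<^sup>+z. ennreal \<bar>Re (- \<i> * b z) - n\<bar> * indicator near z \<partial>lborel)
      \<le> ennreal (2 * osc_const p * \<Lambda> * vol)"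
    by (rule real_part_oscillation[OF bd' p \<open>0 < \<Lambda>\<close>]) measurable
  have "(\<integral>\<^sup>+z. ennreal (norm (b z - Complex m n)) * indicator near z \<partial>lborel)
      \<le> (\<integral>\<^sup>+z. ennreal \<bar>Re (b z) - m\<bar> * indicator near z
          + ennreal \<bar>Re (- \<i> * b z) - n\<bar> * indicator near z \<partial>lborel)"
  proof (rule nn_integral_mono)
    fix z
    have "norm (b z - Complex m n) \<le> \<bar>Re (b z) - m\<bar> + \<bar>Re (- \<i> * b z) - n\<bar>"
      using cmod_le[of "b z - Complex m n"] by simp
    then show "ennreal (norm (b z - Complex m n)) * indicator near z
        \<le> ennreal \<bar>Re (b z) - m\<bar> * indicator near z + ennreal \<bar>Re (- \<i> * b z) - n\<bar> * indicator near z"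
      by (cases "z \<in> near") (auto intro: ennreal_leI simp flip: ennreal_plus)
  qed
  also have "\<dots> = (\<integral>\<^sup>+z. ennreal \<bar>Re (b z) - m\<bar> * indicator near z \<partial>lborel)
      + (\<integral>\<^sup>+z. ennreal \<bar>Re (- \<i> * b z) - n\<bar> * indicator near z \<partial>lborel)"
    by (rule nn_integral_add) measurable
  also have "\<dots> \<le> ennreal (2 * osc_const p * \<Lambda> * vol) + ennreal (2 * osc_const p * \<Lambda> * vol)"
    using m n by (rule add_mono)
  also have "\<dots> = ennreal (4 * osc_const p * \<Lambda> * vol)"
    using osc_const_nonneg[of p] vol_pos \<open>0 < \<Lambda>\<close> by (simp flip: ennreal_plus)
  finally show thesis
    by (rule that)
qed

end

text \<open>
  Up to a factor \<open>2\<close> the average is the best constant: it differs from \<open>\<mu>\<close> by at most the mean of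
  \<open>norm (b - \<mu>)\<close>.
\<close>

lemma mean_oscillation_le:
  fixes b :: "real \<times> real \<Rightarrow> complex"
  assumes b: "set_integrable lebesgue Q b" and Q: "Q \<in> lmeasurable" "0 < measure lebesgue Q"
    and le: "(\<integral>\<^sup>+z. ennreal (norm (b z - \<mu>)) * indicator Q z \<partial>lebesgue) \<le> ennreal r" and "0 \<le> r"
  shows "mean_oscillation Q b \<le> 2 * r / measure lebesgue Q"
proof -
  let ?v = "measure lebesgue Q"
  have const: "set_integrable lebesgue Q (\<lambda>_. \<nu>)" for \<nu> :: "'c :: {banach, second_countable_topology}"
    using Q by (simp add: set_integrable_def integrable_on_indicator fmeasurableD fmeasurableD2 lmeasurable_iff_integrable)
  have diff: "set_integrable lebesgue Q (\<lambda>z. b z - \<nu>)" for \<nu>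
    using b const by (rule set_integral_diff)
  have nrm: "set_integrable lebesgue Q (\<lambda>z. norm (b z - \<nu>))" for \<nu>
    using diff by (rule set_integrable_norm)
  define J where "J = (LINT z:Q|lebesgue. norm (b z - \<mu>))"
  have "ennreal J = (\<integral>\<^sup>+z. ennreal (indicator Q z *\<^sub>R norm (b z - \<mu>)) \<partial>lebesgue)"
    unfolding J_def set_lebesgue_integral_def using nrm[of \<mu>]
    by (intro nn_integral_eq_integral[symmetric]) (auto simp: set_integrable_def)
  also have "\<dots> = (\<integral>\<^sup>+z. ennreal (norm (b z - \<mu>)) * indicator Q z \<partial>lebesgue)"
    by (intro nn_integral_cong) (auto simp: indicator_def)
  finally have J: "J \<le> r"
    using le \<open>0 \<le> r\<close> by (metis ennreal_le_iff)
  have const_int: "(LINT z:Q|lebesgue. \<nu>) = ?v *\<^sub>R \<nu>" for \<nu> :: "'c :: {banach, second_countable_topology}"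
    unfolding set_lebesgue_integral_def using const[of "1::real"]
    by (subst integral_scaleR_left) (auto simp: set_integrable_def)
  have "(LINT z:Q|lebesgue. b z - \<mu>) = ?v *\<^sub>R (average Q b - \<mu>)"
    using set_integral_diff(2)[OF b const, of \<mu>] Q(2)
    by (simp add: const_int average_def scaleR_conv_of_real algebra_simps)
  moreover have "norm (LINT z:Q|lebesgue. b z - \<mu>) \<le> J"
    unfolding J_def using diff by (rule set_integral_norm_bound)
  ultimately have avg: "?v * norm (\<mu> - average Q b) \<le> J"
    using Q(2) by (simp add: norm_minus_commute)
  have "(LINT z:Q|lebesgue. norm (b z - average Q b))
      \<le> (LINT z:Q|lebesgue. norm (b z - \<mu>) + norm (\<mu> - average Q b))"
    using nrm const
    by (intro set_integral_mono set_integral_add) (auto intro: norm_triangle_le_diff order_trans[OF _ norm_triangle_ineq])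
  also have "\<dots> = J + ?v * norm (\<mu> - average Q b)"
    using set_integral_add(2)[OF nrm[of \<mu>] const, of "norm (\<mu> - average Q b)"]
    by (simp add: J_def const_int)
  also have "\<dots> \<le> 2 * r"
    using avg J by simp
  finally show ?thesis
    using Q(2) by (simp add: mean_oscillation_def divide_right_mono)
qed

context two_step
begin

text \<open>
  A commutator bound for \<open>b\<close> yields an off-diagonal bound for a Borel version of \<open>b\<close>, and mean
  oscillations do not change under modification on a null set.
\<close>

lemma mean_oscillation_near_le:
  assumes loc: "locally_integrable b" and bound: "commutator_bound \<beta>1 \<beta>2 p b (ennreal \<Lambda>)"
    and p: "1 < p" and "0 < \<Lambda>"
  shows "mean_oscillation near b \<le> 8 * osc_const p * \<Lambda>"
proof -
  obtain b' where b': "b' \<in> borel_measurable borel" "AE x in lborel. b x = b' x"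
    using ex_borel_version[OF locally_integrable_imp_measurable[OF loc]] .
  obtain \<mu> where \<mu>: "(\<integral>\<^sup>+z. ennreal (norm (b' z - \<mu>)) * indicator near z \<partial>lborel)
      \<le> ennreal (4 * osc_const p * \<Lambda> * vol)"
    using complex_oscillation[OF commutator_bound_imp_offdiag_bound[OF p \<open>0 < \<Lambda>\<close> bound b'] p \<open>0 < \<Lambda>\<close> b'(1)] .
  have "(\<integral>\<^sup>+z. ennreal (norm (b z - \<mu>)) * indicator near z \<partial>lebesgue)
      = (\<integral>\<^sup>+z. ennreal (norm (b' z - \<mu>)) * indicator near z \<partial>lborel)"
    unfolding nn_integral_completion
    by (intro nn_integral_cong_AE) (use b'(2) in eventually_elim, simp)
  with \<mu> have le: "(\<integral>\<^sup>+z. ennreal (norm (b z - \<mu>)) * indicator near z \<partial>lebesgue)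
      \<le> ennreal (4 * osc_const p * \<Lambda> * vol)"
    by simp
  have "compact near"
    unfolding near_def by (intro compact_Times compact_Icc)
  then have "near \<in> lmeasurable" "set_integrable lebesgue near b"
    using loc by (auto simp: lmeasurable_compact locally_integrable_def)
  moreover have "measure lebesgue near = vol"
    using measure_eq_emeasure_eq_ennreal[OF less_imp_le[OF vol_pos] emeasure_near] by simp
  ultimately show ?thesis
    using mean_oscillation_le[OF _ _ _ le] osc_const_nonneg[of p] \<open>0 < \<Lambda>\<close> vol_pos
    by simp
qed

end

theorem theorem1p1:
  fixes \<beta>1 \<beta>2 p :: real
  assumes "0 < \<beta>1" and "\<beta>1 < \<beta>2" and "1 < p"
  shows "\<exists>C::real. 0 \<le> C \<and>
    (\<forall>b. locally_integrable b \<longrightarrow> commutator_bounded \<beta>1 \<beta>2 p b \<longrightarrow>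
       b \<in> BMO \<beta>1 \<beta>2 \<and>
       BMO_norm \<beta>1 \<beta>2 b \<le> ennreal C * commutator_norm \<beta>1 \<beta>2 p b)"
proof -
  have "1 < \<beta>2 / \<beta>1"
    using assms by simp
  then obtain \<delta> where \<delta>: "0 < \<delta>" "\<delta> \<le> 1/4"
    "2 powr (\<beta>2 / \<beta>1) + 1 + \<delta> powr (\<beta>2 / \<beta>1)
      \<le> (9/4) powr (\<beta>2 / \<beta>1) + (3/4 - \<delta>) powr (\<beta>2 / \<beta>1)"
    "(7/4) powr (\<beta>2 / \<beta>1) + (5/4 + \<delta>) powr (\<beta>2 / \<beta>1)
      \<le> 2 powr (\<beta>2 / \<beta>1) + 1 - \<delta> powr (\<beta>2 / \<beta>1)"
    by (rule ex_small_width)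
  have cfg: "two_step \<beta>1 \<beta>2 \<delta> S" if "0 < S" for S
    using assms \<delta> that by unfold_locales
  define C where "C = 8 * two_step.osc_const \<beta>1 \<beta>2 \<delta> p"
  have "0 \<le> C"
    using two_step.osc_const_nonneg[OF cfg[of 1], of p] by (simp add: C_def)
  \<comment> \<open>The scale \<open>S\<close> is chosen so that the given rectangle is \<open>near\<close>;
    \<open>osc_const\<close> does not involve \<open>S\<close> or the corner, so neither does the bound.\<close>
  have BMO_le: "BMO_norm \<beta>1 \<beta>2 b \<le> ennreal (C * \<Lambda>)"
    if loc: "locally_integrable b" and "0 < \<Lambda>" and bound: "commutator_bound \<beta>1 \<beta>2 p b (ennreal \<Lambda>)" for b \<Lambda>
    unfolding BMO_norm_def
  proof (rule SUP_least)
    fix Q assume "Q \<in> curve_rectangles \<beta>1 \<beta>2"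
    then obtain x0 x1 y0 y1 where Q: "Q = {x0..x1} \<times> {y0..y1}" "x0 < x1" "y0 < y1"
      and shape: "(x1 - x0) powr (1 / \<beta>1) = (y1 - y0) powr (1 / \<beta>2)"
      by (auto simp: curve_rectangles_def)
    interpret two_step \<beta>1 \<beta>2 \<delta> "(x1 - x0) / \<delta>" x0 y0
      using Q \<delta> by (intro cfg) simp
    have "y1 - y0 = ((y1 - y0) powr (1 / \<beta>2)) powr \<beta>2"
      using Q assms by (simp add: powr_powr)
    also have "\<dots> = (x1 - x0) powr \<alpha>"
      unfolding shape[symmetric] by (simp add: powr_powr \<alpha>_def)
    finally have "y1 = y0 + (x1 - x0) powr \<alpha>"
      by simp
    then have "Q = near"
      using Q \<delta> by (simp add: near_def)
    then show "ennreal (mean_oscillation Q b) \<le> ennreal (C * \<Lambda>)"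
      using mean_oscillation_near_le[OF loc bound \<open>1 < p\<close> \<open>0 < \<Lambda>\<close>] by (simp add: C_def ennreal_leI)
  qed
  \<comment> \<open>The estimate above needs a positive \<open>\<Lambda>\<close>, so a bound \<open>N\<close>, which may be
    zero, is enlarged slightly.\<close>
  have main: "BMO_norm \<beta>1 \<beta>2 b \<le> ennreal C * N"
    if loc: "locally_integrable b" and bound: "commutator_bound \<beta>1 \<beta>2 p b N" for b N
  proof (rule ennreal_le_epsilon)
    fix \<epsilon> :: real assume "0 < \<epsilon>"
    obtain n where n: "N = ennreal n" "0 \<le> n"
      using bound by (cases N rule: ennreal_cases) (auto simp: commutator_bound_def)
    define \<Lambda> where "\<Lambda> = n + \<epsilon> / (C + 1)"
    have "0 < \<epsilon> / (C + 1)"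
      using \<open>0 < \<epsilon>\<close> \<open>0 \<le> C\<close> by simp
    then have "0 < \<Lambda>" "N \<le> ennreal \<Lambda>"
      using n by (auto simp: \<Lambda>_def intro: ennreal_leI)
    have "commutator_bound \<beta>1 \<beta>2 p b (ennreal \<Lambda>)"
      using bound mult_right_mono[OF \<open>N \<le> ennreal \<Lambda>\<close>]
      unfolding commutator_bound_def by (auto intro: order_trans)
    then have "BMO_norm \<beta>1 \<beta>2 b \<le> ennreal (C * \<Lambda>)"
      by (rule BMO_le[OF loc \<open>0 < \<Lambda>\<close>])
    also have "\<dots> \<le> ennreal (C * n + \<epsilon>)"
      using \<open>0 < \<epsilon>\<close> \<open>0 \<le> C\<close> by (intro ennreal_leI) (simp add: \<Lambda>_def field_simps)
    also have "\<dots> = ennreal C * N + ennreal \<epsilon>"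
      using n \<open>0 < \<epsilon>\<close> \<open>0 \<le> C\<close> by (simp add: ennreal_mult)
    finally show "BMO_norm \<beta>1 \<beta>2 b \<le> ennreal C * N + ennreal \<epsilon>" .
  qed
  have "b \<in> BMO \<beta>1 \<beta>2 \<and> BMO_norm \<beta>1 \<beta>2 b \<le> ennreal C * commutator_norm \<beta>1 \<beta>2 p b"
    if loc: "locally_integrable b" and bdd: "commutator_bounded \<beta>1 \<beta>2 p b" for b
  proof
    obtain N where N: "commutator_bound \<beta>1 \<beta>2 p b N"
      using bdd by (auto simp: commutator_bounded_def)
    have "BMO_norm \<beta>1 \<beta>2 b \<le> ennreal C * N"
      by (rule main[OF loc N])
    also have "\<dots> < \<infinity>"
      using N by (simp add: commutator_bound_def ennreal_mult_less_top)
    finally have "BMO_norm \<beta>1 \<beta>2 b < \<infinity>" .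
    then show "b \<in> BMO \<beta>1 \<beta>2"
      using loc by (simp add: BMO_def)
    show "BMO_norm \<beta>1 \<beta>2 b \<le> ennreal C * commutator_norm \<beta>1 \<beta>2 p b"
    proof (cases "C = 0")
      case True
      then show ?thesis
        using main[OF loc N] by simp
    next
      case False
      with \<open>0 \<le> C\<close> have "0 < C"
        by simp
      obtain k where k: "BMO_norm \<beta>1 \<beta>2 b = ennreal k" "0 \<le> k"
        using \<open>BMO_norm \<beta>1 \<beta>2 b < \<infinity>\<close>
        by (cases "BMO_norm \<beta>1 \<beta>2 b" rule: ennreal_cases) auto
      have "ennreal (k / C) \<le> N'" if N': "commutator_bound \<beta>1 \<beta>2 p b N'" for N'
      proof -
        obtain n where n: "N' = ennreal n" "0 \<le> n"
          using N' by (cases N' rule: ennreal_cases) (auto simp: commutator_bound_def)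
        then have "k \<le> C * n"
          using main[OF loc N'] k \<open>0 < C\<close> by (simp flip: ennreal_mult)
        then show ?thesis
          using n \<open>0 < C\<close> by (simp add: field_simps ennreal_leI)
      qed
      then have "ennreal (k / C) \<le> commutator_norm \<beta>1 \<beta>2 p b"
        unfolding commutator_norm_def by (intro Inf_greatest) auto
      then have "ennreal C * ennreal (k / C) \<le> ennreal C * commutator_norm \<beta>1 \<beta>2 p b"
        by (rule mult_left_mono) simp
      then show ?thesis
        using k \<open>0 < C\<close> by (simp flip: ennreal_mult)
    qed
  qed
  with \<open>0 \<le> C\<close> show ?thesis
    by blast
qed

end
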